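(* Let $k$ be a positive integer and let $\Delta_1,\ldots,\Delta_m$ be positive integers with $\Delta_i\ge p-1\ge 2$ for all $i$ and $kp=\Delta_1+\cdots+ \Delta_m$, where $p$ is an odd integer. Let $G$ be a $(3k-3)$-edge-connected graph satisfying $\Delta(G)\le \Delta_1+\cdots+ \Delta_m$. Then $G$ can be edge-decomposed into factors $G_1,\ldots, G_m$ satisfying $\Delta(G_i)\le \Delta_i$ for all $i$ with $1\le i \le m$, if and only if at least one of the following conditions holds: (1) $|V(G)|$ is even; (2) $\sum_{v\in V(G)}\big(\Delta_1+\cdots+ \Delta_m-d_G(v)\big)\ge |\{i:\Delta_i \text{ is odd}\}|-1$.
   Context: Graphs may have loops and multiple edges; $d_G(v)$ is the degree of $v$ in $G$ (a loop counts twice), and $\Delta(G)$ is the maximum degree of $G$. A factor of $G$ is a spanning subgraph of $G$; $G$ is edge-decomposed into factors $G_1,\ldots,G_m$ if their edge sets partition $E(G)$. For a vertex set $A$, $d_G(A)$ is the number of edges of $G$ with exactly one end in $A$; $G$ is $\lambda$-edge-connected if $d_G(A)\ge\lambda$ for every nonempty proper subset $A$ of $V(G)$. *)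

theory Defs
  imports Main "HOL-Library.Uprod" "HOL-Library.Disjoint_Sets"
begin

text \<open>Edges are named objects, so parallel edges are distinct elements with
  the same ends; a loop at \<open>v\<close> is an edge with ends \<open>Upair v v\<close>.\<close>

record ('v, 'e) mgraph =
  verts :: "'v set"
  edges :: "'e set"
  ends :: "'e \<Rightarrow> 'v uprod"

definition multigraph :: "('v, 'e) mgraph \<Rightarrow> bool" where
  "multigraph G \<longleftrightarrow> finite (verts G) \<and> verts G \<noteq> {} \<and> finite (edges G) \<and>
     (\<forall>e\<in>edges G. set_uprod (ends G e) \<subseteq> verts G)"

text \<open>The second summand makes a loop count twice.\<close>

definition degree :: "('v, 'e) mgraph \<Rightarrow> 'v \<Rightarrow> nat" where
  "degree G v = card {e \<in> edges G. v \<in> set_uprod (ends G e)} + card {e \<in> edges G. ends G e = Upair v v}"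

definition max_degree :: "('v, 'e) mgraph \<Rightarrow> nat" where
  "max_degree G = Max (degree G ` verts G)"

definition cut_size :: "('v, 'e) mgraph \<Rightarrow> 'v set \<Rightarrow> nat" where
  "cut_size G A = card {e \<in> edges G. \<exists>u v. ends G e = Upair u v \<and> u \<in> A \<and> v \<notin> A}"

definition edge_connected :: "nat \<Rightarrow> ('v, 'e) mgraph \<Rightarrow> bool" where
  "edge_connected l G \<longleftrightarrow> (\<forall>A. A \<noteq> {} \<and> A \<subset> verts G \<longrightarrow> l \<le> cut_size G A)"

definition is_factor :: "('v, 'e) mgraph \<Rightarrow> ('v, 'e) mgraph \<Rightarrow> bool" where
  "is_factor H G \<longleftrightarrow> multigraph H \<and> verts H = verts G \<and> edges H \<subseteq> edges G \<and>
     (\<forall>e\<in>edges H. ends H e = ends G e)"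

text \<open>As usual for decompositions into factors, some of the edge sets may be empty.\<close>

definition edge_decomposition :: "('v, 'e) mgraph \<Rightarrow> nat \<Rightarrow> (nat \<Rightarrow> ('v, 'e) mgraph) \<Rightarrow> bool" where
  "edge_decomposition G m F \<longleftrightarrow> (\<forall>i\<in>{1..m}. is_factor (F i) G) \<and>
     disjoint_family_on (\<lambda>i. edges (F i)) {1..m} \<and> (\<Union>i\<in>{1..m}. edges (F i)) = edges G"

end

theory Submission
  imports Defs
begin

text \<open>Let \<open>D = k * p\<close> be the sum of the \<open>\<Delta> i\<close> and let \<open>t\<close> be the number of odd ones. In a decomposition of
a graph of odd order, a factor with an odd bound cannot attain it at every vertex, because its degrees
have an even sum. So each odd \<open>\<Delta> i\<close> costs one unit of the total deficiency, the sum of the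
\<open>D - d(v)\<close>; this is \<open>decomposition_room\<close>. (For odd order the deficiency has the parity of \<open>t\<close>,
so that \<open>t - 1\<close> in the statement is as good as \<open>t\<close>.)

For the converse, an odd \<open>\<Delta> i \<ge> p - 1\<close> is at least \<open>p\<close>, since \<open>p\<close> is odd. Hence \<open>t \<le> k\<close>, and
\<open>k - t\<close> is even. It therefore suffices to colour the edges with \<open>k\<close> colours so that \<open>t\<close> chosen
colours have degrees at most \<open>p\<close> and the other colours together have degrees at most
\<open>(k - t) * p\<close> (\<open>colour_split\<close>): each chosen colour goes to one odd \<open>\<Delta> i\<close>, and what remains of the
bounds, \<open>\<Delta> i - p\<close> or \<open>\<Delta> i\<close>, is even and sums to \<open>(k - t) * p\<close>. Even bounds are always
attainable, by Petersen's argument: balance an orientation and colour the bipartite graph of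
out-ends and in-ends (\<open>even_factors\<close>).

The \<open>k\<close> colours also come from an orientation. If \<open>s = D - d(v)\<close> and the out-degree of \<open>v\<close> is
congruent to \<open>- j\<close> modulo \<open>k\<close> with \<open>0 \<le> j \<le> s\<close>, then an equitable \<open>k\<close>-colouring of the
out-ends and of the in-ends gives every colour degree at most \<open>p\<close> at \<open>v\<close>. The residues must sum
to the number of edges modulo \<open>k\<close>. This can be arranged if the order is even or the deficiency is at
least \<open>k\<close>. Otherwise all vertices but one get residue \<open>0\<close>, and at the last vertex the colours have
degrees \<open>p - 1\<close>, \<open>p\<close> and \<open>p + 1\<close>, few enough of them \<open>p + 1\<close> to choose \<open>t\<close> colours as required
(\<open>choose_classes\<close>).

High edge-connectivity is used only for the existence of the orientation (\<open>modular_orientation\<close>): in a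
\<open>(3k-3)\<close>-edge-connected graph all out-degrees can be prescribed modulo \<open>k\<close>, as long as they sum to
the number of edges. This is a theorem in the spirit of Lovasz, Thomassen, Wu and Zhang. The
induction needs a more general statement (\<open>guarded_orientable\<close>), in which a virtual vertex with
already directed edges is attached to the graph. Its edges only serve to measure how well each
cut is guarded, and may be redistributed freely as long as there are not too many of them.
A minimal counterexample cannot be contracted, lifted or reduced by orienting an edge. Consequently
all its vertices need a net outflow of the same sign; redistributing the virtual edges then
produces either a vertex that needs nothing or a vertex of the other sign, and both are excluded.\<close>

section \<open>Distance to the multiples of 2k\<close>

text \<open>The distance from \<open>z\<close> to the nearest multiple of \<open>2 * k\<close>: the least absolute value of a net outflow that
is congruent to \<open>z\<close>.\<close>
definition residue_norm :: "int \<Rightarrow> int \<Rightarrow> int" where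
  "residue_norm k z = min (z mod (2 * k)) (2 * k - z mod (2 * k))"

lemma residue_norm_le: assumes "k > 0" shows "residue_norm k z \<le> \<bar>z + 2 * k * m\<bar>"
proof -
  define q where "q = z div (2 * k) + m"
  define r where "r = z mod (2 * k)"
  have r: "0 \<le> r" "r < 2 * k" unfolding r_def using assms by auto
  have "z = 2 * k * (z div (2 * k)) + r" unfolding r_def by simp
  then have z: "z + 2 * k * m = 2 * k * q + r" unfolding q_def by (simp add: algebra_simps)
  have n: "residue_norm k z = min r (2 * k - r)" unfolding residue_norm_def r_def by simp
  show ?thesis
  proof (cases "q \<ge> 0")
    case True
    then have "0 \<le> 2 * k * q" using assms by simp
    then show ?thesis unfolding z n using r by linarith
  next
    case False
    then have "k * q \<le> k * (-1)" using assms by (intro mult_left_mono) auto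
    then have "2 * k * q \<le> - 2 * k" by (simp add: algebra_simps)
    then show ?thesis unfolding z n using r by linarith
  qed
qed

lemma residue_norm_attained:
  assumes "k > 0"
  obtains m where "residue_norm k z = \<bar>z + 2 * k * m\<bar>"
proof -
  define r where "r = z mod (2 * k)"
  have r: "0 \<le> r" "r < 2 * k" unfolding r_def using assms by auto
  have n: "residue_norm k z = min r (2 * k - r)" unfolding residue_norm_def r_def by simp
  have "z = 2 * k * (z div (2 * k)) + r" unfolding r_def by simp
  then have a: "z + 2 * k * (- (z div (2 * k))) = r" "z + 2 * k * (- (z div (2 * k)) - 1) = r - 2 * k"
    by (simp_all add: algebra_simps)
  show thesis
  proof (cases "r \<le> k")
    case True
    then have "residue_norm k z = \<bar>r\<bar>" unfolding n using r by simp
    then show thesis unfolding a(1)[symmetric] by (rule that)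
  next
    case False
    then have "residue_norm k z = \<bar>r - 2 * k\<bar>" unfolding n using r by simp
    then show thesis unfolding a(2)[symmetric] by (rule that)
  qed
qed

lemma residue_norm_add: assumes "k > 0" shows "residue_norm k (a + b) \<le> residue_norm k a + residue_norm k b"
proof -
  obtain m1 where 1: "residue_norm k a = \<bar>a + 2 * k * m1\<bar>" using residue_norm_attained assms by blast
  obtain m2 where 2: "residue_norm k b = \<bar>b + 2 * k * m2\<bar>" using residue_norm_attained assms by blast
  have "residue_norm k (a + b) \<le> \<bar>a + b + 2 * k * (m1 + m2)\<bar>" by (rule residue_norm_le[OF assms])
  also have "\<dots> = \<bar>(a + 2 * k * m1) + (b + 2 * k * m2)\<bar>" by (simp add: algebra_simps)
  finally show ?thesis unfolding 1 2 by linarith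
qed

lemma residue_norm_nonneg: assumes "k > 0" shows "0 \<le> residue_norm k z"
  using residue_norm_attained[of k z] assms by (metis abs_ge_zero)

lemma residue_norm_le_abs: assumes "k > 0" shows "residue_norm k z \<le> \<bar>z\<bar>"
  using residue_norm_le[OF assms, of z 0] by simp

lemma residue_norm_le_k: "residue_norm k z \<le> k"
  unfolding residue_norm_def by linarith

text \<open>Orienting or adding one edge changes the required outflow of a set by one, hence its norm by at most one.\<close>
lemma residue_norm_lipschitz: assumes "k > 0" shows "residue_norm k (a + b) \<le> residue_norm k a + \<bar>b\<bar>"
  using residue_norm_add[OF assms, of a b] residue_norm_le_abs[OF assms, of b] by linarith

lemma residue_norm_cong: assumes "2 * k dvd a - b" shows "residue_norm k a = residue_norm k b"
proof -
  have "a mod (2 * k) = b mod (2 * k)" using assms by (simp add: mod_eq_dvd_iff)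
  then show ?thesis unfolding residue_norm_def by simp
qed

lemma residue_norm_minus: assumes "k > 0" shows "residue_norm k (- z) = residue_norm k z"
proof -
  have "residue_norm k (- z) \<le> residue_norm k z" for z
  proof -
    obtain m where 1: "residue_norm k z = \<bar>z + 2 * k * m\<bar>" using residue_norm_attained assms by blast
    have "residue_norm k (- z) \<le> \<bar>- z + 2 * k * (- m)\<bar>" by (rule residue_norm_le[OF assms])
    also have "\<dots> = \<bar>z + 2 * k * m\<bar>" by simp
    finally show ?thesis using 1 by simp
  qed
  from this[of z] this[of "- z"] show ?thesis by simp
qed

lemma residue_norm_parity: assumes "k > 0" shows "even (residue_norm k z - z)"
proof -
  obtain m where 1: "residue_norm k z = \<bar>z + 2 * k * m\<bar>" using residue_norm_attained assms by blast
  show ?thesis unfolding 1 by (auto simp: abs_if)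
qed

lemma residue_norm_low: assumes "0 \<le> z" "z \<le> k" "k > 0" shows "residue_norm k z = z"
  using assms unfolding residue_norm_def by simp

lemma residue_norm_high: assumes "k \<le> z" "z < 2 * k" shows "residue_norm k z = 2 * k - z"
  using assms unfolding residue_norm_def by simp

lemma residue_norm_mod: assumes "k > 0" shows "residue_norm k (z mod (2 * k)) = residue_norm k z"
  unfolding residue_norm_def by simp

lemma residue_norm_pred: assumes "k > 0" "0 < z mod (2 * k)" "z mod (2 * k) \<le> k"
  shows "residue_norm k (z - 1) = residue_norm k z - 1"
proof -
  let ?r = "z mod (2 * k)"
  have "residue_norm k (z - 1) = residue_norm k (?r - 1)"
    by (rule residue_norm_cong) (metis mod_diff_left_eq mod_eq_dvd_iff)
  also have "\<dots> = ?r - 1" by (rule residue_norm_low) (use assms in auto)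
  also have "\<dots> = residue_norm k ?r - 1" using assms residue_norm_low[of ?r k] by simp
  finally show ?thesis using residue_norm_mod[OF assms(1)] by simp
qed

lemma residue_norm_succ: assumes "k > 0" "k \<le> z mod (2 * k)"
  shows "residue_norm k (z + 1) = residue_norm k z - 1"
proof -
  have *: "(- z) mod (2 * k) = 2 * k - z mod (2 * k)"
    using assms by (simp add: zmod_zminus1_eq_if)
  have "z mod (2 * k) < 2 * k" using assms by simp
  then have "residue_norm k (- z - 1) = residue_norm k (- z) - 1" by (intro residue_norm_pred) (use assms * in auto)
  moreover have "- z - 1 = - (z + 1)" by simp
  ultimately show ?thesis using residue_norm_minus[OF assms(1)] by metis
qed

section \<open>Net outflow, cuts and lifting\<close>

text \<open>A graph is a set of edges with a fixed reference direction from \<open>tail\<close> to \<open>head\<close>; an orientation is a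
sign for each edge, \<open>- 1\<close> meaning that the edge is reversed. Loops contribute neither to the net outflow nor
to cuts.\<close>
definition net_outflow :: "'e set \<Rightarrow> ('e \<Rightarrow> 'v) \<Rightarrow> ('e \<Rightarrow> 'v) \<Rightarrow> ('e \<Rightarrow> int) \<Rightarrow> 'v \<Rightarrow> int" where
  "net_outflow E tail head \<sigma> v = (\<Sum>e\<in>E. \<sigma> e * (of_bool (tail e = v) - of_bool (head e = v)))"

definition cut_count :: "'e set \<Rightarrow> ('e \<Rightarrow> 'v) \<Rightarrow> ('e \<Rightarrow> 'v) \<Rightarrow> 'v set \<Rightarrow> int" where
  "cut_count E tail head A = (\<Sum>e\<in>E. of_bool ((tail e \<in> A) \<noteq> (head e \<in> A)))"

definition sign_valued :: "('e \<Rightarrow> int) \<Rightarrow> bool" where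
  "sign_valued \<sigma> \<longleftrightarrow> (\<forall>e. \<sigma> e = 1 \<or> \<sigma> e = - 1)"

definition joins :: "('e \<Rightarrow> 'v) \<Rightarrow> ('e \<Rightarrow> 'v) \<Rightarrow> 'e \<Rightarrow> 'v \<Rightarrow> 'v \<Rightarrow> bool" where
  "joins tail head e u v \<longleftrightarrow> (tail e = u \<and> head e = v) \<or> (tail e = v \<and> head e = u)"

lemma joins_sign:
  assumes "joins tail head e u v"
  obtains s :: int where "s = 1 \<or> s = - 1"
    "\<And>x. s * (of_bool (tail e = x) - of_bool (head e = x)) = of_bool (u = x) - of_bool (v = x)"
  using assms unfolding joins_def
  by (metis minus_diff_eq mult_1 mult_minus1)

lemma net_outflow_sum:
  assumes "finite A"
  shows "(\<Sum>v\<in>A. net_outflow E tail head \<sigma> v) = (\<Sum>e\<in>E. \<sigma> e * (of_bool (tail e \<in> A) - of_bool (head e \<in> A)))"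
proof -
  have b: "(\<Sum>v\<in>A. of_bool (x = v)) = (of_bool (x \<in> A) :: int)" for x
    using assms by (simp add: of_bool_def)
  have "(\<Sum>v\<in>A. net_outflow E tail head \<sigma> v)
      = (\<Sum>e\<in>E. \<Sum>v\<in>A. \<sigma> e * (of_bool (tail e = v) - of_bool (head e = v)))"
    unfolding net_outflow_def by (rule sum.swap)
  then show ?thesis by (simp add: sum_distrib_left[symmetric] sum_subtractf b)
qed

lemma net_outflow_parity:
  assumes "sign_valued \<sigma>" "finite A" "finite E"
  shows "even (cut_count E tail head A - (\<Sum>v\<in>A. net_outflow E tail head \<sigma> v))"
proof -
  have "even (\<Sum>e\<in>E. of_bool ((tail e \<in> A) \<noteq> (head e \<in> A)) - \<sigma> e * (of_bool (tail e \<in> A) - of_bool (head e \<in> A)))"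
  proof (rule dvd_sum)
    fix e
    have "\<sigma> e = 1 \<or> \<sigma> e = - 1" using assms(1) unfolding sign_valued_def by blast
    then show "even (of_bool ((tail e \<in> A) \<noteq> (head e \<in> A)) - \<sigma> e * (of_bool (tail e \<in> A) - of_bool (head e \<in> A)))"
      by auto
  qed
  then show ?thesis unfolding net_outflow_sum[OF assms(2)] cut_count_def by (simp add: sum_subtractf)
qed

lemma net_outflow_parity1:
  assumes "sign_valued \<sigma>" "finite E"
  shows "even (cut_count E tail head {v} - net_outflow E tail head \<sigma> v)"
  using net_outflow_parity[OF assms(1) _ assms(2), of "{v}"] by simp

lemma cut_count_parity:
  assumes "finite A" "finite E"
  shows "even (cut_count E tail head A - (\<Sum>v\<in>A. cut_count E tail head {v}))"
proof -
  let ?s = "\<lambda>_. 1 :: int"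
  have s: "sign_valued ?s" unfolding sign_valued_def by simp
  have "even (\<Sum>v\<in>A. cut_count E tail head {v} - net_outflow E tail head ?s v)"
    by (rule dvd_sum) (rule net_outflow_parity1[OF s assms(2)])
  moreover have "even (cut_count E tail head A - (\<Sum>v\<in>A. net_outflow E tail head ?s v))"
    by (rule net_outflow_parity[OF s assms])
  ultimately show ?thesis by (simp add: sum_subtractf)
qed

lemma cut_count_remove:
  assumes "finite E" "e \<in> E"
  shows "cut_count E tail head A = cut_count (E - {e}) tail head A + of_bool ((tail e \<in> A) \<noteq> (head e \<in> A))"
  unfolding cut_count_def sum.remove[OF assms] by simp

lemma net_outflow_remove:
  assumes "finite E" "e \<in> E"
  shows "net_outflow E tail head \<sigma> v = net_outflow (E - {e}) tail head \<sigma> v + \<sigma> e * (of_bool (tail e = v) - of_bool (head e = v))"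
  unfolding net_outflow_def sum.remove[OF assms] by simp

lemma net_outflow_cong:
  assumes "\<And>e. e \<in> E \<Longrightarrow> \<sigma> e = \<sigma>' e \<and> tail e = tail' e \<and> head e = head' e"
  shows "net_outflow E tail head \<sigma> v = net_outflow E tail' head' \<sigma>' v"
  unfolding net_outflow_def using assms by (intro sum.cong) auto

text \<open>Lifting: two edges \<open>a y\<close> and \<open>y b\<close> are replaced by one edge \<open>a b\<close>. An orientation of the new graph gives one of the old
graph with the same net outflows, by following the new edge through \<open>y\<close>.\<close>
lemma lift_net_outflow:
  assumes "finite E" "e1 \<in> E" "e2 \<in> E" "e1 \<noteq> e2" "sign_valued \<sigma>'"
    and j: "joins tail head e1 a y" "joins tail head e2 y b"
  obtains \<sigma> where "sign_valued \<sigma>"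
    "\<And>v. net_outflow E tail head \<sigma> v = net_outflow (E - {e2}) (tail(e1 := a)) (head(e1 := b)) \<sigma>' v"
proof -
  obtain s1 :: int where s1: "s1 = 1 \<or> s1 = - 1"
    "\<And>x. s1 * (of_bool (tail e1 = x) - of_bool (head e1 = x)) = of_bool (a = x) - of_bool (y = x)"
    using joins_sign[OF j(1)] by metis
  obtain s2 :: int where s2: "s2 = 1 \<or> s2 = - 1"
    "\<And>x. s2 * (of_bool (tail e2 = x) - of_bool (head e2 = x)) = of_bool (y = x) - of_bool (b = x)"
    using joins_sign[OF j(2)] by metis
  define \<sigma> where "\<sigma> = \<sigma>'(e1 := \<sigma>' e1 * s1, e2 := \<sigma>' e1 * s2)"
  have "\<sigma>' e1 = 1 \<or> \<sigma>' e1 = - 1" using assms(5) unfolding sign_valued_def by blast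
  then have sg: "sign_valued \<sigma>" using assms(5) s1(1) s2(1) unfolding sign_valued_def \<sigma>_def by auto
  have eq: "net_outflow E tail head \<sigma> v = net_outflow (E - {e2}) (tail(e1 := a)) (head(e1 := b)) \<sigma>' v" for v
  proof -
    let ?R = "E - {e2} - {e1}"
    have "net_outflow E tail head \<sigma> v = net_outflow ?R tail head \<sigma> v + \<sigma> e1 * (of_bool (tail e1 = v) - of_bool (head e1 = v))
        + \<sigma> e2 * (of_bool (tail e2 = v) - of_bool (head e2 = v))"
      using net_outflow_remove[of E e2 tail head \<sigma> v] net_outflow_remove[of "E - {e2}" e1 tail head \<sigma> v] assms(1-4) by simp
    also have "\<sigma> e1 * (of_bool (tail e1 = v) - of_bool (head e1 = v)) = \<sigma>' e1 * (of_bool (a = v) - of_bool (y = v))"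
      using s1(2)[of v] assms(4) unfolding \<sigma>_def by (simp add: mult.assoc)
    also have "\<sigma> e2 * (of_bool (tail e2 = v) - of_bool (head e2 = v)) = \<sigma>' e1 * (of_bool (y = v) - of_bool (b = v))"
      using s2(2)[of v] assms(4) unfolding \<sigma>_def by (simp add: mult.assoc)
    also have "net_outflow ?R tail head \<sigma> v = net_outflow ?R (tail(e1 := a)) (head(e1 := b)) \<sigma>' v"
      by (rule net_outflow_cong) (auto simp: \<sigma>_def)
    finally show ?thesis
      using net_outflow_remove[of "E - {e2}" e1 "tail(e1 := a)" "head(e1 := b)" \<sigma>' v] assms(1-4)
      by (simp add: algebra_simps)
  qed
  show thesis by (rule that[OF sg eq])
qed

text \<open>Lifting at a vertex with two non-loop edges leaves all net outflows unchanged, so a graph with at most one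
non-loop edge at each vertex remains, and there every orientation is balanced.\<close>
lemma balanced_orientation:
  assumes "finite E"
  shows "\<exists>\<sigma>. sign_valued \<sigma> \<and> (\<forall>v. \<bar>net_outflow E tail head \<sigma> v\<bar> \<le> 1)"
  using assms
proof (induction "card E" arbitrary: E tail head rule: less_induct)
  case less
  show ?case
  proof (cases "\<exists>y a b e1 e2. e1 \<in> E \<and> e2 \<in> E \<and> e1 \<noteq> e2 \<and> joins tail head e1 a y \<and> joins tail head e2 y b \<and> a \<noteq> y \<and> b \<noteq> y")
    case True
    then obtain y a b e1 e2 where e: "e1 \<in> E" "e2 \<in> E" "e1 \<noteq> e2"
      and j: "joins tail head e1 a y" "joins tail head e2 y b" by blast
    have "card (E - {e2}) < card E" using e less.prems by (meson card_Diff1_less)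
    then obtain \<sigma>' where s: "sign_valued \<sigma>'" "\<forall>v. \<bar>net_outflow (E - {e2}) (tail(e1 := a)) (head(e1 := b)) \<sigma>' v\<bar> \<le> 1"
      using less.hyps less.prems by blast
    show ?thesis using lift_net_outflow[OF less.prems e s(1) j] s(2) by metis
  next
    case False
    have "\<bar>net_outflow E tail head (\<lambda>_. 1) v\<bar> \<le> 1" for v
    proof -
      let ?N = "{e \<in> E. (tail e = v) \<noteq> (head e = v)}"
      have "e1 = e2" if e12: "e1 \<in> ?N" "e2 \<in> ?N" for e1 e2
      proof (rule ccontr)
        assume ne: "e1 \<noteq> e2"
        obtain a where a: "joins tail head e1 a v" "a \<noteq> v" using e12(1) unfolding joins_def by auto
        obtain b where b: "joins tail head e2 v b" "b \<noteq> v" using e12(2) unfolding joins_def by auto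
        show False using False e12 ne a b by blast
      qed
      then have N: "?N = {} \<or> (\<exists>e. ?N = {e})" by blast
      have "net_outflow E tail head (\<lambda>_. 1) v = (\<Sum>e\<in>?N. of_bool (tail e = v) - of_bool (head e = v))"
        unfolding net_outflow_def using less.prems by (intro sum.mono_neutral_cong_right) auto
      moreover have "\<bar>\<Sum>e\<in>?N. of_bool (tail e = v) - of_bool (head e = v) :: int\<bar> \<le> 1"
        using N
      proof (elim disjE)
        assume "?N = {}"
        then show ?thesis by (simp only: sum.empty)
      next
        assume "\<exists>e. ?N = {e}"
        then obtain e where "?N = {e}" by blast
        then show ?thesis by simp
      qed
      ultimately show ?thesis by simp
    qed
    moreover have "sign_valued (\<lambda>_. 1 :: int)" unfolding sign_valued_def by simp
    ultimately show ?thesis by blast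
  qed
qed

lemma net_outflow_bound:
  assumes "sign_valued \<sigma>" "finite E"
  shows "\<bar>net_outflow E tail head \<sigma> v\<bar> \<le> cut_count E tail head {v}"
proof -
  have "\<bar>net_outflow E tail head \<sigma> v\<bar> \<le> (\<Sum>e\<in>E. \<bar>\<sigma> e * (of_bool (tail e = v) - of_bool (head e = v))\<bar>)"
    unfolding net_outflow_def by (rule sum_abs)
  also have "\<dots> \<le> cut_count E tail head {v}" unfolding cut_count_def
  proof (rule sum_mono)
    fix e
    have "\<sigma> e = 1 \<or> \<sigma> e = - 1" using assms(1) unfolding sign_valued_def by blast
    then show "\<bar>\<sigma> e * (of_bool (tail e = v) - of_bool (head e = v))\<bar>
        \<le> of_bool ((tail e \<in> {v}) \<noteq> (head e \<in> {v}))" by auto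
  qed
  finally show ?thesis .
qed

lemma net_outflow_split:
  assumes "finite E" "D \<subseteq> E"
  shows "net_outflow E tail head \<sigma> v = net_outflow D tail head \<sigma> v + net_outflow (E - D) tail head \<sigma> v"
  unfolding net_outflow_def sum.subset_diff[OF assms(2,1)] by simp

lemma cut_count_split:
  assumes "finite E" "D \<subseteq> E"
  shows "cut_count E tail head A = cut_count D tail head A + cut_count (E - D) tail head A"
  unfolding cut_count_def sum.subset_diff[OF assms(2,1)] by simp

lemma net_outflow_untouched:
  assumes "\<And>e. e \<in> E \<Longrightarrow> (tail e = v) = (head e = v)"
  shows "net_outflow E tail head \<sigma> v = 0"
  unfolding net_outflow_def using assms by (intro sum.neutral) auto

lemma cut_count_compl:
  assumes "\<And>e. e \<in> E \<Longrightarrow> tail e \<in> C \<and> head e \<in> C"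
  shows "cut_count E tail head (C - A) = cut_count E tail head A"
  unfolding cut_count_def using assms by (intro sum.cong) auto

lemma cut_count_pos:
  assumes "cut_count E tail head A > 0"
  obtains e where "e \<in> E" "(tail e \<in> A) \<noteq> (head e \<in> A)"
proof (rule ccontr)
  assume "\<not> thesis"
  with that have "\<And>e. e \<in> E \<Longrightarrow> (tail e \<in> A) = (head e \<in> A)" by blast
  then have "cut_count E tail head A = 0" unfolding cut_count_def by (intro sum.neutral) auto
  with assms show False by simp
qed

lemma sum_of_bool_eq: "finite A \<Longrightarrow> (\<Sum>v\<in>A. of_bool (v = x)) = (of_bool (x \<in> A) :: int)"
  by (simp add: of_bool_def)

section \<open>Prescribed net outflows modulo 2k\<close>

text \<open>The obvious necessary conditions on a prescription \<open>\<gamma>\<close> of the net outflows modulo \<open>2 * k\<close>: net outflows sum to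
zero and have the parity of the degree.\<close>
definition boundary :: "int \<Rightarrow> 'v set \<Rightarrow> 'e set \<Rightarrow> ('e \<Rightarrow> 'v) \<Rightarrow> ('e \<Rightarrow> 'v) \<Rightarrow> ('v \<Rightarrow> int) \<Rightarrow> bool" where
  "boundary k C E tail head \<gamma> \<longleftrightarrow> finite C \<and> finite E \<and> (\<forall>e\<in>E. tail e \<in> C \<and> head e \<in> C) \<and>
     2 * k dvd sum \<gamma> C \<and> (\<forall>v\<in>C. even (\<gamma> v - cut_count E tail head {v}))"

definition orientable :: "int \<Rightarrow> 'v set \<Rightarrow> 'e set \<Rightarrow> ('e \<Rightarrow> 'v) \<Rightarrow> ('e \<Rightarrow> 'v) \<Rightarrow> ('v \<Rightarrow> int) \<Rightarrow> bool" where
  "orientable k C E tail head \<gamma> \<longleftrightarrow>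
     (\<exists>\<sigma>. sign_valued \<sigma> \<and> (\<forall>v\<in>C. 2 * k dvd \<gamma> v - net_outflow E tail head \<sigma> v))"

text \<open>Imagine a virtual vertex joined to each \<open>v\<close> by \<open>p v\<close> edges whose directions are fixed, \<open>n v\<close> being the number of
those that enter \<open>v\<close> minus the number of those that leave it. If these edges are counted, \<open>v\<close> needs the net
outflow \<open>\<gamma> v - n v\<close>, and the cut of a set \<open>A\<close> has \<open>cut_count A + sum p A\<close> edges. Every set without the virtual vertex is asked to
have \<open>2 * k - 2\<close> edges in its cut beyond the norm of its required outflow; the virtual vertex
itself must not have too many edges, for otherwise its directions could contradict \<open>\<gamma>\<close>. One vertex \<open>w\<close> that
requires outflow \<open>0\<close> need not be guarded, which permits lifting its edges one pair after the other.\<close>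
definition guarded :: "int \<Rightarrow> 'v set \<Rightarrow> 'e set \<Rightarrow> ('e \<Rightarrow> 'v) \<Rightarrow> ('e \<Rightarrow> 'v) \<Rightarrow> ('v \<Rightarrow> int)
    \<Rightarrow> ('v \<Rightarrow> int) \<Rightarrow> ('v \<Rightarrow> int) \<Rightarrow> 'v \<Rightarrow> bool" where
  "guarded k C E tail head \<gamma> n p w \<longleftrightarrow>
     (\<forall>v\<in>C. \<bar>n v\<bar> \<le> p v \<and> even (p v - n v)) \<and>
     sum p C \<le> 2 * k - 2 + residue_norm k (sum n C) \<and>
     (\<forall>A. A \<noteq> {} \<and> A \<subset> C \<and> \<not> (A = {w} \<and> 2 * k dvd \<gamma> w - n w) \<longrightarrow>
       2 * k - 2 + residue_norm k (\<Sum>v\<in>A. \<gamma> v - n v) \<le> cut_count E tail head A + sum p A)"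

text \<open>Contraction of \<open>A\<close> to its element \<open>a\<close>. The edges inside \<open>A\<close> stay as loops, so that the edge set does not change.\<close>
definition merge :: "'v set \<Rightarrow> 'v \<Rightarrow> 'v \<Rightarrow> 'v" where
  "merge A a v = (if v \<in> A then a else v)"

definition merged :: "('v \<Rightarrow> int) \<Rightarrow> 'v set \<Rightarrow> 'v \<Rightarrow> 'v \<Rightarrow> int" where
  "merged f A a v = (if v = a then sum f A else f v)"

lemma sum_merged:
  assumes "finite C" "A \<subseteq> C" "a \<in> A" "B \<subseteq> insert a (C - A)"
  shows "sum (merged f A a) B = sum f (if a \<in> B then B \<union> A else B)"
proof (cases "a \<in> B")
  case True
  have fin: "finite A" "finite B"
    using finite_subset[OF assms(2,1)] finite_subset[OF assms(4)] assms(1) by auto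
  have "sum (merged f A a) B = sum f A + sum (merged f A a) (B - {a})"
    using sum.remove[OF fin(2) True, of "merged f A a"] by (simp add: merged_def)
  also have "sum (merged f A a) (B - {a}) = sum f (B - {a})"
    by (intro sum.cong) (auto simp: merged_def)
  also have "sum f A + sum f (B - {a}) = sum f (A \<union> (B - {a}))"
    using fin assms by (intro sum.union_disjoint[symmetric]) auto
  also have "A \<union> (B - {a}) = B \<union> A" using assms by auto
  finally show ?thesis using True by simp
next
  case False
  then have "sum (merged f A a) B = sum f B" by (intro sum.cong) (auto simp: merged_def)
  then show ?thesis using False by simp
qed

lemma cut_count_merge:
  assumes "\<And>e. e \<in> E \<Longrightarrow> tail e \<in> C \<and> head e \<in> C" "A \<subseteq> C" "a \<in> A" "B \<subseteq> insert a (C - A)"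
  shows "cut_count E (merge A a \<circ> tail) (merge A a \<circ> head) B = cut_count E tail head (if a \<in> B then B \<union> A else B)"
proof -
  have "merge A a x \<in> B \<longleftrightarrow> x \<in> (if a \<in> B then B \<union> A else B)" if "x \<in> C" for x
    using assms that unfolding merge_def by auto
  then show ?thesis unfolding cut_count_def using assms(1) by (intro sum.cong) auto
qed

lemma net_outflow_merge_out:
  assumes "a \<in> A" "v \<notin> A"
  shows "net_outflow E (merge A a \<circ> tail) (merge A a \<circ> head) \<sigma> v = net_outflow E tail head \<sigma> v"
proof -
  have "merge A a x = v \<longleftrightarrow> x = v" for x using assms unfolding merge_def by auto
  then show ?thesis unfolding net_outflow_def by simp
qed

lemma net_outflow_merge_in:
  assumes "finite A" "a \<in> A"
  shows "net_outflow E (merge A a \<circ> tail) (merge A a \<circ> head) \<sigma> a = (\<Sum>v\<in>A. net_outflow E tail head \<sigma> v)"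
proof -
  have "merge A a x = a \<longleftrightarrow> x \<in> A" for x using assms unfolding merge_def by auto
  then show ?thesis unfolding net_outflow_sum[OF assms(1)] by (simp add: net_outflow_def)
qed

lemma even_sum_boundary:
  assumes "boundary k C E tail head \<gamma>" "A \<subseteq> C"
  shows "even (sum \<gamma> A - cut_count E tail head A)"
proof -
  have fin: "finite A" "finite E" using assms finite_subset unfolding boundary_def by auto
  have "even (\<Sum>v\<in>A. \<gamma> v - cut_count E tail head {v})"
    using assms unfolding boundary_def by (intro dvd_sum) auto
  moreover have "even (cut_count E tail head A - (\<Sum>v\<in>A. cut_count E tail head {v}))"
    by (rule cut_count_parity[OF fin])
  ultimately show ?thesis by (simp add: sum_subtractf)
qed

lemma boundary_merge:
  assumes bd: "boundary k C E tail head \<gamma>" and A: "A \<subseteq> C" "a \<in> A"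
  shows "boundary k (insert a (C - A)) E (merge A a \<circ> tail) (merge A a \<circ> head) (merged \<gamma> A a)"
proof -
  have E: "\<And>e. e \<in> E \<Longrightarrow> tail e \<in> C \<and> head e \<in> C" and fin: "finite C"
    using bd unfolding boundary_def by auto
  have CA: "insert a (C - A) \<union> A = C" using A by auto
  have s: "sum (merged \<gamma> A a) (insert a (C - A)) = sum \<gamma> C"
    using sum_merged[OF fin A, of "insert a (C - A)" \<gamma>] CA by simp
  have "even (merged \<gamma> A a v - cut_count E (merge A a \<circ> tail) (merge A a \<circ> head) {v})"
    if v: "v \<in> insert a (C - A)" for v
  proof -
    have b: "cut_count E (merge A a \<circ> tail) (merge A a \<circ> head) {v} = cut_count E tail head (if a \<in> {v} then {v} \<union> A else {v})"
      by (rule cut_count_merge[OF E A]) (use v in auto)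
    show ?thesis
    proof (cases "v = a")
      case True
      then have "{v} \<union> A = A" using A by auto
      then show ?thesis using even_sum_boundary[OF bd A(1)] True b by (simp add: merged_def)
    next
      case False
      then show ?thesis using bd b v unfolding boundary_def merged_def by auto
    qed
  qed
  moreover have "merge A a x \<in> insert a (C - A)" if "x \<in> C" for x
    using that unfolding merge_def by auto
  ultimately show ?thesis using bd s unfolding boundary_def by auto
qed

text \<open>Cuts of the contracted graph are cuts of the graph. As \<open>A\<close> has two elements, no cut with the contracted vertex on
the guarded side is the exempted singleton.\<close>
lemma guarded_merge:
  assumes bd: "boundary k C E tail head \<gamma>" and g: "guarded k C E tail head \<gamma> n p w"
    and A: "A \<subseteq> C" "a \<in> A" "card A \<ge> 2"
  shows "guarded k (insert a (C - A)) E (merge A a \<circ> tail) (merge A a \<circ> head)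
    (merged \<gamma> A a) (merged n A a) (merged p A a) w"
proof -
  have E: "\<And>e. e \<in> E \<Longrightarrow> tail e \<in> C \<and> head e \<in> C" and fin: "finite C"
    using bd unfolding boundary_def by auto
  have np: "\<And>v. v \<in> C \<Longrightarrow> \<bar>n v\<bar> \<le> p v \<and> even (p v - n v)"
    and z: "sum p C \<le> 2 * k - 2 + residue_norm k (sum n C)"
    and cuts: "\<And>B. B \<noteq> {} \<Longrightarrow> B \<subset> C \<Longrightarrow> \<not> (B = {w} \<and> 2 * k dvd \<gamma> w - n w) \<Longrightarrow>
       2 * k - 2 + residue_norm k (\<Sum>v\<in>B. \<gamma> v - n v) \<le> cut_count E tail head B + sum p B"
    using g unfolding guarded_def by auto
  have CA: "insert a (C - A) \<union> A = C" using A by auto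
  have s: "sum (merged f A a) (insert a (C - A)) = sum f C" for f
    using sum_merged[OF fin A(1,2), of "insert a (C - A)" f] CA by simp
  have np': "\<bar>merged n A a v\<bar> \<le> merged p A a v \<and> even (merged p A a v - merged n A a v)"
    if "v \<in> insert a (C - A)" for v
  proof (cases "v = a")
    case True
    have "\<bar>sum n A\<bar> \<le> (\<Sum>v\<in>A. \<bar>n v\<bar>)" by (rule sum_abs)
    also have "\<dots> \<le> sum p A" using np A by (intro sum_mono) auto
    finally have "\<bar>sum n A\<bar> \<le> sum p A" .
    moreover have "even (\<Sum>v\<in>A. p v - n v)" using np A by (intro dvd_sum) auto
    ultimately show ?thesis using True by (simp add: merged_def sum_subtractf)
  next
    case False
    then show ?thesis using np that by (auto simp: merged_def)
  qed
  have cuts': "2 * k - 2 + residue_norm k (\<Sum>v\<in>B. merged \<gamma> A a v - merged n A a v)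
      \<le> cut_count E (merge A a \<circ> tail) (merge A a \<circ> head) B + sum (merged p A a) B"
    if B: "B \<noteq> {}" "B \<subset> insert a (C - A)" "\<not> (B = {w} \<and> 2 * k dvd merged \<gamma> A a w - merged n A a w)" for B
  proof -
    let ?B = "if a \<in> B then B \<union> A else B"
    have B': "B \<subseteq> insert a (C - A)" using B by auto
    have 1: "?B \<noteq> {}" using B by auto
    have 2: "?B \<subset> C"
    proof -
      obtain c where c: "c \<in> insert a (C - A)" "c \<notin> B" using B(2) by blast
      have "?B \<subseteq> C" using B' A by auto
      moreover have "c \<in> C \<and> c \<notin> ?B" if "a \<in> B" using that c by auto
      moreover have "a \<in> C \<and> a \<notin> ?B" if "a \<notin> B" using that A by auto
      ultimately show ?thesis by (cases "a \<in> B") blast+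
    qed
    have 3: "\<not> (?B = {w} \<and> 2 * k dvd \<gamma> w - n w)"
    proof (cases "a \<in> B")
      case True
      then have "A \<subseteq> ?B" by auto
      moreover have "finite ?B" using 2 fin finite_subset by blast
      ultimately have "card ?B \<ge> 2" using A(3) card_mono by (meson order_trans)
      then show ?thesis by force
    next
      case False
      then show ?thesis using B(3) by (auto simp: merged_def)
    qed
    have b: "cut_count E (merge A a \<circ> tail) (merge A a \<circ> head) B = cut_count E tail head ?B"
      by (rule cut_count_merge[OF E A(1,2) B'])
    show ?thesis
      using cuts[OF 1 2 3] unfolding b sum_subtractf sum_merged[OF fin A(1,2) B'] .
  qed
  show ?thesis unfolding guarded_def s
  proof (intro conjI ballI allI impI)
    show "sum p C \<le> 2 * k - 2 + residue_norm k (sum n C)" by (rule z)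
  qed (use np' cuts' in auto)
qed

text \<open>A minimal counterexample, measured by its vertices and edges. The virtual edges \<open>n\<close>, \<open>p\<close> and the exempted vertex are no
part of the problem to be solved, so that they may be replaced by any others that guard the cuts.\<close>
locale critical =
  fixes k :: int and C :: "'v set" and E :: "'e set" and tail head :: "'e \<Rightarrow> 'v" and \<gamma> :: "'v \<Rightarrow> int"
  assumes k2: "k \<ge> 2"
    and bd: "boundary k C E tail head \<gamma>"
    and stuck: "\<not> orientable k C E tail head \<gamma>"
    and smaller: "\<And>(C' :: 'v set) (E' :: 'e set) tail' head' \<gamma>' n p w.
      card C' + card E' < card C + card E \<Longrightarrow> boundary k C' E' tail' head' \<gamma>' \<Longrightarrow>
      guarded k C' E' tail' head' \<gamma>' n p w \<Longrightarrow> orientable k C' E' tail' head' \<gamma>'"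
begin

lemma kpos: "k > 0" using k2 by simp

lemma finC: "finite C" and finE: "finite E"
  and ends: "\<And>e. e \<in> E \<Longrightarrow> tail e \<in> C \<and> head e \<in> C"
  and total: "2 * k dvd sum \<gamma> C"
  and even_vertex: "\<And>v. v \<in> C \<Longrightarrow> even (\<gamma> v - cut_count E tail head {v})"
  using bd unfolding boundary_def by auto

lemma finA: "A \<subseteq> C \<Longrightarrow> finite A" using finC finite_subset by blast

lemma card_C: "card C \<ge> 2"
proof (rule ccontr)
  assume "\<not> card C \<ge> 2"
  then have one: "u = v" if "u \<in> C" "v \<in> C" for u v
    using that finC card_le_Suc0_iff_eq[of C] by auto
  have "2 * k dvd \<gamma> v - net_outflow E tail head (\<lambda>_. 1) v" if v: "v \<in> C" for v
  proof -
    have "C = {v}" using v one by auto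
    moreover have "net_outflow E tail head (\<lambda>_. 1) v = 0"
      by (rule net_outflow_untouched) (use ends one v in metis)
    ultimately show ?thesis using total by simp
  qed
  moreover have "sign_valued (\<lambda>_. 1 :: int)" unfolding sign_valued_def by simp
  ultimately show False using stuck unfolding orientable_def by blast
qed

lemma parity:
  assumes "guarded k C E tail head \<gamma> n p w" "A \<subseteq> C"
  shows "even (cut_count E tail head A + sum p A - residue_norm k (\<Sum>v\<in>A. \<gamma> v - n v))"
proof -
  have "even (\<Sum>v\<in>A. p v - n v)"
    using assms unfolding guarded_def by (intro dvd_sum) auto
  moreover have "even (sum \<gamma> A - cut_count E tail head A)" by (rule even_sum_boundary[OF bd assms(2)])
  moreover have "even (residue_norm k (\<Sum>v\<in>A. \<gamma> v - n v) - (\<Sum>v\<in>A. \<gamma> v - n v))" by (rule residue_norm_parity[OF kpos])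
  ultimately show ?thesis by (simp add: sum_subtractf)
qed

lemma total_residue_norm: "residue_norm k (\<Sum>v\<in>C. \<gamma> v - n v) = residue_norm k (sum n C)"
proof -
  have "residue_norm k (\<Sum>v\<in>C. \<gamma> v - n v) = residue_norm k (- sum n C)"
    by (rule residue_norm_cong) (use total in \<open>simp add: sum_subtractf\<close>)
  then show ?thesis using residue_norm_minus[OF kpos] by simp
qed

lemma merge_orientation:
  assumes g: "guarded k C E tail head \<gamma> n p w" and A: "A \<subseteq> C" "card A \<ge> 2"
  obtains \<sigma> where "sign_valued \<sigma>" "\<And>v. v \<in> C - A \<Longrightarrow> 2 * k dvd \<gamma> v - net_outflow E tail head \<sigma> v"
    "2 * k dvd sum \<gamma> A - (\<Sum>v\<in>A. net_outflow E tail head \<sigma> v)"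
proof -
  obtain a where a: "a \<in> A" using A(2) by fastforce
  have fA: "finite A" by (rule finA[OF A(1)])
  have "card (insert a (C - A)) = Suc (card C - card A)"
    using a finC A fA by (simp add: card_Diff_subset)
  moreover have "card A \<le> card C" by (rule card_mono[OF finC A(1)])
  ultimately have "card (insert a (C - A)) + card E < card C + card E" using A(2) by linarith
  then have "orientable k (insert a (C - A)) E (merge A a \<circ> tail) (merge A a \<circ> head) (merged \<gamma> A a)"
    by (rule smaller[OF _ boundary_merge[OF bd A(1) a] guarded_merge[OF bd g A(1) a A(2)]])
  then obtain \<sigma> where s: "sign_valued \<sigma>"
    and o: "\<And>v. v \<in> insert a (C - A) \<Longrightarrow>
      2 * k dvd merged \<gamma> A a v - net_outflow E (merge A a \<circ> tail) (merge A a \<circ> head) \<sigma> v"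
    unfolding orientable_def by blast
  have 1: "2 * k dvd \<gamma> v - net_outflow E tail head \<sigma> v" if "v \<in> C - A" for v
  proof -
    have "v \<noteq> a" "v \<notin> A" using that a by auto
    then show ?thesis using o[of v] that net_outflow_merge_out[OF a \<open>v \<notin> A\<close>, of E tail head \<sigma>] by (simp add: merged_def)
  qed
  have 2: "2 * k dvd sum \<gamma> A - (\<Sum>v\<in>A. net_outflow E tail head \<sigma> v)"
    using o[of a] net_outflow_merge_in[OF fA a, of E tail head \<sigma>] by (simp add: merged_def)
  show thesis by (rule that[OF s 1 2])
qed

text \<open>A tight cut allows a reduction to two smaller problems. First orient the graph in which \<open>A\<close> is contracted. Then
everything outside \<open>A\<close> becomes the virtual vertex for the graph on \<open>A\<close>, with the edges of the cut directed as found;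
tightness is exactly the bound on the number of virtual edges. Since slacks are even, the cuts of all sets
with at least two elements have slack \<open>2\<close>.\<close>
lemma slack:
  assumes g: "guarded k C E tail head \<gamma> n p w" and A: "A \<subset> C" "card A \<ge> 2"
  shows "2 * k + residue_norm k (\<Sum>v\<in>A. \<gamma> v - n v) \<le> cut_count E tail head A + sum p A"
proof (rule ccontr)
  assume contr: "\<not> ?thesis"
  have AC: "A \<subseteq> C" using A by auto
  have fA: "finite A" by (rule finA[OF AC])
  have np: "\<And>v. v \<in> C \<Longrightarrow> \<bar>n v\<bar> \<le> p v \<and> even (p v - n v)"
    and cuts: "\<And>B. B \<noteq> {} \<Longrightarrow> B \<subset> C \<Longrightarrow> \<not> (B = {w} \<and> 2 * k dvd \<gamma> w - n w) \<Longrightarrow>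
       2 * k - 2 + residue_norm k (\<Sum>v\<in>B. \<gamma> v - n v) \<le> cut_count E tail head B + sum p B"
    using g unfolding guarded_def by auto
  have "A \<noteq> {}" "A \<noteq> {w}" using A(2) by auto
  then have "2 * k - 2 + residue_norm k (\<Sum>v\<in>A. \<gamma> v - n v) \<le> cut_count E tail head A + sum p A"
    using cuts A(1) by blast
  with contr parity[OF g AC] have tight:
    "cut_count E tail head A + sum p A = 2 * k - 2 + residue_norm k (\<Sum>v\<in>A. \<gamma> v - n v)" by presburger
  obtain \<sigma>1 where s1: "sign_valued \<sigma>1" and o1: "\<And>v. v \<in> C - A \<Longrightarrow> 2 * k dvd \<gamma> v - net_outflow E tail head \<sigma>1 v"
    and oA: "2 * k dvd sum \<gamma> A - (\<Sum>v\<in>A. net_outflow E tail head \<sigma>1 v)"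
    using merge_orientation[OF g AC A(2)] by metis
  \<comment> \<open>\<open>c v\<close> is the outflow that \<open>v\<close> already has from the \<open>q v\<close> cut edges at \<open>v\<close>, so these turn into virtual edges\<close>
  define EA where "EA = {e \<in> E. tail e \<in> A \<and> head e \<in> A}"
  define X where "X = E - EA"
  have EAE: "EA \<subseteq> E" unfolding EA_def by auto
  have fX: "finite X" "finite EA" using finE EAE finite_subset unfolding X_def by auto
  define c where "c v = net_outflow X tail head \<sigma>1 v" for v
  define q where "q v = cut_count X tail head {v}" for v
  have bX: "cut_count X tail head B = sum q B" if B: "B \<subseteq> A" for B
  proof -
    have fB: "finite B" using B fA finite_subset by blast
    have "sum q B = (\<Sum>e\<in>X. \<Sum>v\<in>B. of_bool ((tail e \<in> {v}) \<noteq> (head e \<in> {v})))"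
      unfolding q_def cut_count_def by (rule sum.swap)
    also have "\<dots> = cut_count X tail head B" unfolding cut_count_def
    proof (rule sum.cong[OF refl])
      fix e assume "e \<in> X"
      then have "\<not> (tail e \<in> B \<and> head e \<in> B)" using B unfolding X_def EA_def by auto
      then have "(\<Sum>v\<in>B. of_bool ((tail e \<in> {v}) \<noteq> (head e \<in> {v})))
          = (\<Sum>v\<in>B. of_bool (v = tail e) + of_bool (v = head e) :: int)"
        by (intro sum.cong) auto
      also have "\<dots> = of_bool (tail e \<in> B) + of_bool (head e \<in> B)"
        by (simp only: sum.distrib sum_of_bool_eq[OF fB])
      also have "\<dots> = of_bool ((tail e \<in> B) \<noteq> (head e \<in> B))"
        using \<open>\<not> (tail e \<in> B \<and> head e \<in> B)\<close> by auto
      finally show "(\<Sum>v\<in>B. of_bool ((tail e \<in> {v}) \<noteq> (head e \<in> {v})))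
          = (of_bool ((tail e \<in> B) \<noteq> (head e \<in> B)) :: int)" .
    qed
    finally show ?thesis by simp
  qed
  have bs: "cut_count E tail head B = cut_count EA tail head B + cut_count X tail head B" for B
    unfolding X_def by (rule cut_count_split[OF finE EAE])
  have ns: "net_outflow E tail head \<sigma> v = net_outflow EA tail head \<sigma> v + net_outflow X tail head \<sigma> v" for \<sigma> v
    unfolding X_def by (rule net_outflow_split[OF finE EAE])
  have "cut_count EA tail head A = 0" unfolding cut_count_def EA_def by (intro sum.neutral) auto
  then have bA: "cut_count E tail head A = sum q A" using bs[of A] bX[of A] by simp
  have "(\<Sum>v\<in>A. net_outflow EA tail head \<sigma>1 v) = 0"
    unfolding net_outflow_sum[OF fA] EA_def by (intro sum.neutral) auto
  then have nA: "(\<Sum>v\<in>A. net_outflow E tail head \<sigma>1 v) = sum c A"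
    unfolding ns c_def by (simp add: sum.distrib)
  have cq: "\<bar>c v\<bar> \<le> q v" "even (q v - c v)" for v
    unfolding c_def q_def by (rule net_outflow_bound[OF s1 fX(1)], rule net_outflow_parity1[OF s1 fX(1)])
  define \<gamma>' where "\<gamma>' v = \<gamma> v - c v" for v
  define n' where "n' v = n v - c v" for v
  define p' where "p' v = p v + q v" for v
  have t': "\<gamma>' v - n' v = \<gamma> v - n v" for v unfolding \<gamma>'_def n'_def by simp
  have "boundary k A EA tail head \<gamma>'"
    unfolding boundary_def
  proof (intro conjI ballI)
    show "2 * k dvd sum \<gamma>' A" using oA nA unfolding \<gamma>'_def by (simp add: sum_subtractf)
    fix v assume v: "v \<in> A"
    have "even (\<gamma> v - cut_count E tail head {v})" using even_vertex v AC by auto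
    then show "even (\<gamma>' v - cut_count EA tail head {v})"
      using cq(2)[of v] bs[of "{v}"] unfolding \<gamma>'_def q_def by presburger
  qed (use fA fX in \<open>auto simp: EA_def\<close>)
  moreover have "guarded k A EA tail head \<gamma>' n' p' w"
    unfolding guarded_def t'
  proof (intro conjI ballI allI impI)
    fix v assume v: "v \<in> A"
    then have "\<bar>n v\<bar> \<le> p v \<and> even (p v - n v)" using np AC by auto
    then show "\<bar>n' v\<bar> \<le> p' v" "even (p' v - n' v)"
      using cq[of v] unfolding n'_def p'_def by (linarith, presburger)
  next
    have "residue_norm k (sum n' A) = residue_norm k (- (\<Sum>v\<in>A. \<gamma> v - n v))"
      by (rule residue_norm_cong) (use oA nA in \<open>simp add: n'_def sum_subtractf\<close>)
    then have "residue_norm k (sum n' A) = residue_norm k (\<Sum>v\<in>A. \<gamma> v - n v)" using residue_norm_minus[OF kpos] by simp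
    then show "sum p' A \<le> 2 * k - 2 + residue_norm k (sum n' A)"
      using tight bA unfolding p'_def by (simp add: sum.distrib)
  next
    fix B assume B: "B \<noteq> {} \<and> B \<subset> A \<and> \<not> (B = {w} \<and> 2 * k dvd \<gamma> w - n w)"
    then have "2 * k - 2 + residue_norm k (\<Sum>v\<in>B. \<gamma> v - n v) \<le> cut_count E tail head B + sum p B"
      by (intro cuts) (use AC in auto)
    then show "2 * k - 2 + residue_norm k (\<Sum>v\<in>B. \<gamma> v - n v) \<le> cut_count EA tail head B + sum p' B"
      using bs[of B] bX[of B] B unfolding p'_def by (simp add: sum.distrib psubset_imp_subset)
  qed
  moreover have "card A + card EA < card C + card E"
    using psubset_card_mono[OF finC A(1)] card_mono[OF finE EAE] by linarith
  ultimately have "orientable k A EA tail head \<gamma>'" using smaller by blast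
  then obtain \<sigma>2 where s2: "sign_valued \<sigma>2" and o2: "\<And>v. v \<in> A \<Longrightarrow> 2 * k dvd \<gamma>' v - net_outflow EA tail head \<sigma>2 v"
    unfolding orientable_def by blast
  define \<sigma> where "\<sigma> e = (if e \<in> EA then \<sigma>2 e else \<sigma>1 e)" for e
  have s: "sign_valued \<sigma>" using s1 s2 unfolding sign_valued_def \<sigma>_def by simp
  have n\<sigma>: "net_outflow E tail head \<sigma> v = net_outflow EA tail head \<sigma>2 v + c v" for v
  proof -
    have "net_outflow EA tail head \<sigma> v = net_outflow EA tail head \<sigma>2 v" by (rule net_outflow_cong) (auto simp: \<sigma>_def)
    moreover have "net_outflow X tail head \<sigma> v = c v"
      unfolding c_def by (rule net_outflow_cong) (auto simp: \<sigma>_def X_def)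
    ultimately show ?thesis using ns by simp
  qed
  have "2 * k dvd \<gamma> v - net_outflow E tail head \<sigma> v" if v: "v \<in> C" for v
  proof (cases "v \<in> A")
    case True
    then show ?thesis using o2[OF True] unfolding n\<sigma> \<gamma>'_def by (simp add: algebra_simps)
  next
    case False
    have "net_outflow EA tail head \<tau> v = 0" for \<tau>
      by (rule net_outflow_untouched) (use False in \<open>auto simp: EA_def\<close>)
    then have "net_outflow E tail head \<sigma> v = net_outflow E tail head \<sigma>1 v" using n\<sigma> ns[of \<sigma>1 v] unfolding c_def by simp
    then show ?thesis using o1 v False by simp
  qed
  then show False using s stuck unfolding orientable_def by blast
qed

text \<open>Orienting an edge, from \<open>u\<close> to \<open>x\<close> if \<open>\<delta> = 1\<close>, and deleting it gives a smaller problem, which therefore cannot be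
guarded.\<close>
lemma no_oriented_deletion:
  assumes e: "e \<in> E" "joins tail head e u x" "u \<noteq> x" and \<delta>: "\<delta> = 1 \<or> \<delta> = (- 1 :: int)"
    and g: "guarded k C (E - {e}) tail head
      (\<lambda>v. \<gamma> v - \<delta> * of_bool (v = u) + \<delta> * of_bool (v = x)) n p w"
  shows False
proof -
  let ?g = "\<lambda>v. \<gamma> v - \<delta> * of_bool (v = u) + \<delta> * of_bool (v = x)"
  have ux: "u \<in> C" "x \<in> C" using ends[OF e(1)] e(2) unfolding joins_def by auto
  have b: "boundary k C (E - {e}) tail head ?g"
    unfolding boundary_def
  proof (intro conjI ballI)
    have "sum ?g C = sum \<gamma> C - \<delta> * (\<Sum>v\<in>C. of_bool (v = u)) + \<delta> * (\<Sum>v\<in>C. of_bool (v = x))"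
      by (simp only: sum.distrib sum_subtractf sum_distrib_left)
    then show "2 * k dvd sum ?g C" using total ux unfolding sum_of_bool_eq[OF finC] by simp
    fix v assume v: "v \<in> C"
    have "cut_count E tail head {v} = cut_count (E - {e}) tail head {v} + of_bool (v = u \<or> v = x)"
      unfolding cut_count_remove[OF finE e(1)] using e(2,3) unfolding joins_def by auto
    then show "even (?g v - cut_count (E - {e}) tail head {v})"
      using even_vertex[OF v] \<delta> e(3) by (cases "v = u"; cases "v = x") auto
  qed (use finC finE ends in auto)
  have "card (E - {e}) < card E" using e finE by (meson card_Diff1_less)
  then have "orientable k C (E - {e}) tail head ?g"
    by (intro smaller[OF _ b g]) simp
  then obtain \<sigma>' where s': "sign_valued \<sigma>'" and o': "\<And>v. v \<in> C \<Longrightarrow> 2 * k dvd ?g v - net_outflow (E - {e}) tail head \<sigma>' v"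
    unfolding orientable_def by blast
  obtain s :: int where s: "s = 1 \<or> s = - 1"
    "\<And>v. s * (of_bool (tail e = v) - of_bool (head e = v)) = of_bool (u = v) - of_bool (x = v)"
    using joins_sign[OF e(2)] by metis
  define \<sigma> where "\<sigma> = \<sigma>'(e := \<delta> * s)"
  have "sign_valued \<sigma>" using s' s(1) \<delta> unfolding sign_valued_def \<sigma>_def by auto
  moreover have "2 * k dvd \<gamma> v - net_outflow E tail head \<sigma> v" if v: "v \<in> C" for v
  proof -
    have "net_outflow (E - {e}) tail head \<sigma> v = net_outflow (E - {e}) tail head \<sigma>' v"
      by (rule net_outflow_cong) (auto simp: \<sigma>_def)
    moreover have "\<sigma> e * (of_bool (tail e = v) - of_bool (head e = v)) = \<delta> * (of_bool (u = v) - of_bool (x = v))"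
      unfolding \<sigma>_def using s(2)[of v] by (simp add: mult.assoc)
    ultimately have "net_outflow E tail head \<sigma> v = net_outflow (E - {e}) tail head \<sigma>' v + \<delta> * (of_bool (u = v) - of_bool (x = v))"
      using net_outflow_remove[OF finE e(1)] by metis
    then have "\<gamma> v - net_outflow E tail head \<sigma> v = ?g v - net_outflow (E - {e}) tail head \<sigma>' v"
      by (auto simp: algebra_simps)
    then show ?thesis using o'[OF v] by metis
  qed
  ultimately show False using stuck unfolding orientable_def by blast
qed

lemma shifted_sum:
  assumes "A \<subseteq> C"
  shows "(\<Sum>v\<in>A. (f v - \<delta> * of_bool (v = u) + \<delta> * of_bool (v = x)) - g v)
    = (\<Sum>v\<in>A. f v - g v) - \<delta> * of_bool (u \<in> A) + \<delta> * (of_bool (x \<in> A) :: int)"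
proof -
  have "(\<Sum>v\<in>A. (f v - \<delta> * of_bool (v = u) + \<delta> * of_bool (v = x)) - g v)
    = (\<Sum>v\<in>A. f v - g v) - \<delta> * (\<Sum>v\<in>A. of_bool (v = u)) + \<delta> * (\<Sum>v\<in>A. of_bool (v = x))"
    by (simp only: sum.distrib sum_subtractf sum_distrib_left)
  then show ?thesis unfolding sum_of_bool_eq[OF finA[OF assms]] .
qed

lemma cut_bound:
  assumes "guarded k C E tail head \<gamma> n p w" "A \<noteq> {}" "A \<subset> C" "\<not> (A = {w} \<and> 2 * k dvd \<gamma> w - n w)"
  shows "2 * k - 2 + residue_norm k (\<Sum>v\<in>A. \<gamma> v - n v) \<le> cut_count E tail head A + sum p A"
  using assms(1)[unfolded guarded_def, THEN conjunct2, THEN conjunct2, rule_format, of A] assms(2-4)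
  by simp

text \<open>The complement of \<open>w\<close> requires as much outflow as the virtual vertex provides. Its cut is guarded, and
the virtual vertex has few edges, so at least \<open>p w\<close> of the guarding edges must come from \<open>w\<close>.\<close>
lemma zero_vertex_edges:
  assumes g: "guarded k C E tail head \<gamma> n p w" and w: "w \<in> C" "2 * k dvd \<gamma> w - n w"
  shows "p w \<le> cut_count E tail head {w}"
proof -
  let ?A = "C - {w}"
  have "C \<noteq> {w}" using card_C by auto
  then have ne: "?A \<noteq> {}" "?A \<subset> C" "?A \<noteq> {w}" using w(1) by auto
  have z: "sum p C \<le> 2 * k - 2 + residue_norm k (sum n C)" using g unfolding guarded_def by simp
  have "(\<Sum>v\<in>?A. \<gamma> v - n v) - (\<Sum>v\<in>C. \<gamma> v - n v) = - (\<gamma> w - n w)"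
    unfolding sum.remove[OF finC w(1), of "\<lambda>v. \<gamma> v - n v"] by simp
  then have "2 * k dvd (\<Sum>v\<in>?A. \<gamma> v - n v) - (\<Sum>v\<in>C. \<gamma> v - n v)"
    using w(2) by (simp only: dvd_minus_iff)
  then have "residue_norm k (\<Sum>v\<in>?A. \<gamma> v - n v) = residue_norm k (\<Sum>v\<in>C. \<gamma> v - n v)"
    by (rule residue_norm_cong)
  moreover have "2 * k - 2 + residue_norm k (\<Sum>v\<in>?A. \<gamma> v - n v) \<le> cut_count E tail head ?A + sum p ?A"
    by (rule cut_bound[OF g ne(1,2)]) (use ne in simp)
  moreover have "sum p C = p w + sum p ?A" by (rule sum.remove[OF finC w(1)])
  moreover have "cut_count E tail head ?A = cut_count E tail head {w}" by (rule cut_count_compl) (rule ends)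
  ultimately show ?thesis using z total_residue_norm[of n] by linarith
qed

text \<open>A vertex without required outflow passes its virtual edges on: a virtual edge at \<open>w\<close> and an edge \<open>w a\<close> are lifted to
a virtual edge at \<open>a\<close>. Only cuts that separate \<open>w\<close> from both ends lose edges, and they lose two.\<close>
lemma zero_vertex_anchored:
  assumes g: "guarded k C E tail head \<gamma> n p w" and w: "w \<in> C" "2 * k dvd \<gamma> w - n w" and pw: "p w > 0"
  shows False
proof -
  have np: "\<And>v. v \<in> C \<Longrightarrow> \<bar>n v\<bar> \<le> p v \<and> even (p v - n v)"
    and z: "sum p C \<le> 2 * k - 2 + residue_norm k (sum n C)"
    and cuts: "\<And>B. B \<noteq> {} \<Longrightarrow> B \<subset> C \<Longrightarrow> B \<noteq> {w} \<Longrightarrow>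
       2 * k - 2 + residue_norm k (\<Sum>v\<in>B. \<gamma> v - n v) \<le> cut_count E tail head B + sum p B"
    using g unfolding guarded_def by auto
  have "cut_count E tail head {w} > 0" using zero_vertex_edges[OF g w] pw by simp
  then obtain e where e: "e \<in> E" "(tail e \<in> {w}) \<noteq> (head e \<in> {w})" by (rule cut_count_pos)
  then obtain a where j: "joins tail head e w a" and aw: "w \<noteq> a" unfolding joins_def by auto
  have a: "a \<in> C" using ends[OF e(1)] j unfolding joins_def by auto
  \<comment> \<open>the direction of the lifted virtual edge: into \<open>w\<close> unless all of them leave \<open>w\<close>\<close>
  define \<delta> :: int where "\<delta> = (if n w = - p w then - 1 else 1)"
  have \<delta>: "\<delta> = 1 \<or> \<delta> = - 1" unfolding \<delta>_def by simp
  have n\<delta>: "\<bar>n w - \<delta>\<bar> \<le> p w - 1" 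
  proof -
    have "\<bar>n w\<bar> \<le> p w" "even (p w - n w)" using np[OF w(1)] by auto
    then show ?thesis using pw unfolding \<delta>_def by presburger
  qed
  let ?g = "\<lambda>v. \<gamma> v - \<delta> * of_bool (v = w) + \<delta> * of_bool (v = a)"
  define n' where "n' v = n v - \<delta> * of_bool (v = w) + \<delta> * of_bool (v = a)" for v
  define p' where "p' v = p v - 1 * of_bool (v = w) + 1 * of_bool (v = a)" for v
  have sums: "sum n' A = sum n A - \<delta> * of_bool (w \<in> A) + \<delta> * of_bool (a \<in> A)"
    "sum p' A = sum p A - of_bool (w \<in> A) + of_bool (a \<in> A)" if "A \<subseteq> C" for A
    unfolding n'_def p'_def
    using shifted_sum[OF that, of n \<delta> w a "\<lambda>_. 0"] shifted_sum[OF that, of p 1 w a "\<lambda>_. 0"] by simp_all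
  have t: "?g v - n' v = \<gamma> v - n v" for v unfolding n'_def by simp
  have "guarded k C (E - {e}) tail head ?g n' p' w"
    unfolding guarded_def t
  proof (intro conjI ballI allI impI)
    fix v assume v: "v \<in> C"
    show "\<bar>n' v\<bar> \<le> p' v" using np[OF v] n\<delta> \<delta> aw unfolding n'_def p'_def by auto
    show "even (p' v - n' v)" using np[OF v] \<delta> aw unfolding n'_def p'_def by auto
  next
    show "sum p' C \<le> 2 * k - 2 + residue_norm k (sum n' C)" using z w(1) a by (simp add: sums)
  next
    fix A assume A: "A \<noteq> {} \<and> A \<subset> C \<and> \<not> (A = {w} \<and> 2 * k dvd \<gamma> w - n w)"
    then have Aw: "A \<noteq> {}" "A \<subset> C" "A \<noteq> {w}" using w(2) by auto
    have b: "cut_count E tail head A = cut_count (E - {e}) tail head A + of_bool ((w \<in> A) \<noteq> (a \<in> A))"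
      unfolding cut_count_remove[OF finE e(1)] using j unfolding joins_def by auto
    have AC: "A \<subseteq> C" using Aw by auto
    show "2 * k - 2 + residue_norm k (\<Sum>v\<in>A. \<gamma> v - n v) \<le> cut_count (E - {e}) tail head A + sum p' A"
    proof (cases "w \<in> A \<and> a \<notin> A")
      case True
      have "card A \<ge> 2"
      proof (rule ccontr)
        assume "\<not> card A \<ge> 2"
        then have "A = {w}" using True finA[OF AC] card_le_Suc0_iff_eq[of A] by auto
        with Aw show False by simp
      qed
      then show ?thesis using slack[OF g Aw(2)] b True sums(2)[OF AC] by simp
    next
      case False
      then show ?thesis using cuts[OF Aw] b sums(2)[OF AC] by auto
    qed
  qed
  then show False by (rule no_oriented_deletion[OF e(1) j aw \<delta>])
qed

text \<open>The vertex \<open>w\<close> is exempted from guarding, so it may lose edges; all other cuts that lose edges belong to sets with at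
least two elements, and those have slack.\<close>
lemma zero_vertex_lift:
  assumes g: "guarded k C E tail head \<gamma> n p w" and w: "w \<in> C" "2 * k dvd \<gamma> w - n w"
    and e: "e1 \<in> E" "e2 \<in> E" "e1 \<noteq> e2" and j: "joins tail head e1 a w" "joins tail head e2 w b"
    and ne: "a \<noteq> w" "b \<noteq> w" "a \<noteq> b"
  shows False
proof -
  let ?E = "E - {e2}" and ?t = "tail(e1 := a)" and ?h = "head(e1 := b)"
  have ab: "a \<in> C" "b \<in> C" using ends[OF e(1)] ends[OF e(2)] j unfolding joins_def by auto
  have b: "cut_count E tail head A = cut_count ?E ?t ?h A + of_bool ((a \<in> A) \<noteq> (w \<in> A)) + of_bool ((w \<in> A) \<noteq> (b \<in> A))
      - of_bool ((a \<in> A) \<noteq> (b \<in> A))" for A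
  proof -
    have "cut_count (?E - {e1}) tail head A = cut_count (?E - {e1}) ?t ?h A"
      unfolding cut_count_def by (intro sum.cong) auto
    moreover have "((tail e1 \<in> A) \<noteq> (head e1 \<in> A)) = ((a \<in> A) \<noteq> (w \<in> A))"
      "((tail e2 \<in> A) \<noteq> (head e2 \<in> A)) = ((w \<in> A) \<noteq> (b \<in> A))"
      using j unfolding joins_def by auto
    ultimately show ?thesis
      using cut_count_remove[OF finE e(2), of tail head A] cut_count_remove[of ?E e1 tail head A]
        cut_count_remove[of ?E e1 ?t ?h A] finE e by simp
  qed
  have "boundary k C ?E ?t ?h \<gamma>"
    unfolding boundary_def
  proof (intro conjI ballI)
    fix v assume v: "v \<in> C"
    show "even (\<gamma> v - cut_count ?E ?t ?h {v})"
      using even_vertex[OF v] b[of "{v}"] ne by (cases "v = a"; cases "v = b"; cases "v = w") auto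
  qed (use finC finE ends total ab in auto)
  moreover have "guarded k C ?E ?t ?h \<gamma> n p w"
    unfolding guarded_def
  proof (intro conjI ballI allI impI)
    fix A assume A: "A \<noteq> {} \<and> A \<subset> C \<and> \<not> (A = {w} \<and> 2 * k dvd \<gamma> w - n w)"
    then have Aw: "A \<noteq> {}" "A \<subset> C" "A \<noteq> {w}" using w(2) by auto
    have fA: "finite A" using finA Aw by blast
    have base: "2 * k - 2 + residue_norm k (\<Sum>v\<in>A. \<gamma> v - n v) \<le> cut_count E tail head A + sum p A"
      using cut_bound[OF g] A by simp
    show "2 * k - 2 + residue_norm k (\<Sum>v\<in>A. \<gamma> v - n v) \<le> cut_count ?E ?t ?h A + sum p A"
    proof (cases "(a \<in> A) = (b \<in> A) \<and> (a \<in> A) \<noteq> (w \<in> A)")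
      case True
      have "card A \<ge> 2"
      proof (rule ccontr)
        assume "\<not> card A \<ge> 2"
        then have "\<And>x y. x \<in> A \<Longrightarrow> y \<in> A \<Longrightarrow> x = y" using fA card_le_Suc0_iff_eq[of A] by auto
        then show False using True Aw ne by (cases "w \<in> A") auto
      qed
      then have "2 * k + residue_norm k (\<Sum>v\<in>A. \<gamma> v - n v) \<le> cut_count E tail head A + sum p A" by (rule slack[OF g Aw(2)])
      moreover have "cut_count E tail head A = cut_count ?E ?t ?h A + 2"
        using b[of A] True by (cases "a \<in> A"; cases "w \<in> A") auto
      ultimately show ?thesis by linarith
    next
      case False
      then have "of_bool ((a \<in> A) \<noteq> (w \<in> A)) + of_bool ((w \<in> A) \<noteq> (b \<in> A)) = (of_bool ((a \<in> A) \<noteq> (b \<in> A)) :: int)"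
        by (cases "a \<in> A"; cases "b \<in> A"; cases "w \<in> A") simp_all
      then show ?thesis using base b[of A] by linarith
    qed
  qed (use g in \<open>auto simp: guarded_def\<close>)
  moreover have "card ?E < card E" using e finE by (meson card_Diff1_less)
  ultimately have "orientable k C ?E ?t ?h \<gamma>" by (intro smaller) auto
  then obtain \<sigma>' where s': "sign_valued \<sigma>'" "\<And>v. v \<in> C \<Longrightarrow> 2 * k dvd \<gamma> v - net_outflow ?E ?t ?h \<sigma>' v"
    unfolding orientable_def by blast
  obtain \<sigma> where "sign_valued \<sigma>" "\<And>v. net_outflow E tail head \<sigma> v = net_outflow ?E ?t ?h \<sigma>' v"
    using lift_net_outflow[OF finE e s'(1) j] by metis
  then show False using s'(2) stuck unfolding orientable_def by metis
qed

text \<open>If no virtual edge and no pair of edges can be lifted at \<open>w\<close>, all edges leaving \<open>w\<close> run to one neighbour \<open>a\<close>.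
They are even in number, so after contracting \<open>a\<close> and \<open>w\<close> they can be balanced, which gives \<open>w\<close> outflow \<open>0\<close>.\<close>
lemma zero_vertex:
  assumes g: "guarded k C E tail head \<gamma> n p w" and w: "w \<in> C" "2 * k dvd \<gamma> w - n w"
  shows False
proof (cases "p w > 0")
  case True
  then show False using zero_vertex_anchored[OF g w] by blast
next
  case False
  have "\<bar>n w\<bar> \<le> p w" using g w unfolding guarded_def by auto
  then have nw: "n w = 0" "p w = 0" using False by auto
  have \<gamma>w: "2 * k dvd \<gamma> w" using w nw by simp
  have "\<exists>a\<in>C. a \<noteq> w \<and> (\<forall>e\<in>E. (tail e = w) \<noteq> (head e = w) \<longrightarrow> joins tail head e w a)"
  proof (cases "\<exists>e\<in>E. (tail e = w) \<noteq> (head e = w)")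
    case True
    then obtain e where e: "e \<in> E" "(tail e = w) \<noteq> (head e = w)" by blast
    then obtain a where a: "joins tail head e a w" "a \<noteq> w" unfolding joins_def by auto
    have "joins tail head e' w a" if e': "e' \<in> E" "(tail e' = w) \<noteq> (head e' = w)" for e'
    proof -
      obtain b where b: "joins tail head e' w b" "b \<noteq> w" using e'(2) unfolding joins_def by auto
      have "a = b"
      proof (cases "e = e'")
        case True
        then show ?thesis using a b unfolding joins_def by auto
      next
        case False
        then show ?thesis using zero_vertex_lift[OF g w e(1) e'(1) False a(1) b(1) a(2) b(2)] by blast
      qed
      then show ?thesis using b by simp
    qed
    moreover have "a \<in> C" using ends[OF e(1)] a unfolding joins_def by auto
    ultimately show ?thesis using a(2) by blast
  next
    case False
    have "C \<noteq> {w}" using card_C by auto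
    then show ?thesis using False w(1) by blast
  qed
  then obtain a where a: "a \<in> C" "a \<noteq> w"
    and single: "\<And>e. e \<in> E \<Longrightarrow> (tail e = w) \<noteq> (head e = w) \<Longrightarrow> joins tail head e w a" by blast
  let ?A = "{a, w}"
  have A: "?A \<subseteq> C" "card ?A \<ge> 2" using a w by auto
  obtain \<sigma>1 where s1: "sign_valued \<sigma>1" and o1: "\<And>v. v \<in> C - ?A \<Longrightarrow> 2 * k dvd \<gamma> v - net_outflow E tail head \<sigma>1 v"
    and oA: "2 * k dvd sum \<gamma> ?A - (\<Sum>v\<in>?A. net_outflow E tail head \<sigma>1 v)"
    using merge_orientation[OF g A] by metis
  define Q where "Q = {e \<in> E. joins tail head e w a}"
  have QE: "Q \<subseteq> E" and fQ: "finite Q" using finE unfolding Q_def by auto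
  obtain \<sigma>2 where s2: "sign_valued \<sigma>2" and bal: "\<And>v. \<bar>net_outflow Q tail head \<sigma>2 v\<bar> \<le> 1"
    using balanced_orientation[OF fQ] by blast
  have "cut_count (E - Q) tail head {w} = 0" unfolding cut_count_def
    by (intro sum.neutral) (use single in \<open>auto simp: Q_def\<close>)
  then have "cut_count Q tail head {w} = cut_count E tail head {w}" using cut_count_split[OF finE QE, of tail head "{w}"] by simp
  moreover have "even (\<gamma> w)" using dvd_trans[OF dvd_triv_left \<gamma>w] .
  ultimately have "even (net_outflow Q tail head \<sigma>2 w)"
    using net_outflow_parity1[OF s2 fQ, of tail head w] even_vertex[OF w(1)] by auto
  then have z: "net_outflow Q tail head \<sigma>2 w = 0" using bal[of w] by presburger
  define \<sigma> where "\<sigma> e = (if e \<in> Q then \<sigma>2 e else \<sigma>1 e)" for e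
  have s: "sign_valued \<sigma>" using s1 s2 unfolding sign_valued_def \<sigma>_def by simp
  have ns: "net_outflow E tail head \<tau> v = net_outflow Q tail head \<tau> v + net_outflow (E - Q) tail head \<tau> v" for \<tau> v
    by (rule net_outflow_split[OF finE QE])
  have nQ: "net_outflow Q tail head \<sigma> v = net_outflow Q tail head \<sigma>2 v" for v by (rule net_outflow_cong) (auto simp: \<sigma>_def)
  have nR: "net_outflow (E - Q) tail head \<sigma> v = net_outflow (E - Q) tail head \<sigma>1 v" for v by (rule net_outflow_cong) (auto simp: \<sigma>_def)
  have "net_outflow (E - Q) tail head \<sigma> w = 0" by (rule net_outflow_untouched) (use single in \<open>auto simp: Q_def\<close>)
  then have netw: "net_outflow E tail head \<sigma> w = 0" using ns nQ z by simp
  have Q0: "(\<Sum>v\<in>?A. net_outflow Q tail head \<tau> v) = 0" for \<tau>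
    by (subst net_outflow_sum) (auto simp: Q_def joins_def intro!: sum.neutral)
  have "(\<Sum>v\<in>?A. net_outflow E tail head \<sigma> v) = (\<Sum>v\<in>?A. net_outflow E tail head \<sigma>1 v)"
    unfolding ns sum.distrib Q0 nR ..
  then have oA': "2 * k dvd (\<gamma> a + \<gamma> w) - net_outflow E tail head \<sigma> a" using oA netw a(2) by simp
  have "2 * k dvd \<gamma> v - net_outflow E tail head \<sigma> v" if v: "v \<in> C" for v
  proof -
    consider "v = w" | "v = a" | "v \<in> C - ?A" using v by blast
    then show ?thesis
    proof cases
      case 1
      then show ?thesis using netw \<gamma>w by simp
    next
      case 2
      have "\<gamma> a - net_outflow E tail head \<sigma> a = ((\<gamma> a + \<gamma> w) - net_outflow E tail head \<sigma> a) - \<gamma> w" by simp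
      then show ?thesis using 2 oA' \<gamma>w by (metis dvd_diff)
    next
      case 3
      have "net_outflow Q tail head \<tau> v = 0" for \<tau>
        by (rule net_outflow_untouched) (use 3 in \<open>auto simp: Q_def joins_def\<close>)
      then have "net_outflow E tail head \<sigma> v = net_outflow E tail head \<sigma>1 v" using ns nR by simp
      then show ?thesis using o1[OF 3] by simp
    qed
  qed
  then show False using s stuck unfolding orientable_def by blast
qed

lemma guarded_all:
  assumes g: "guarded k C E tail head \<gamma> n p w" and A: "A \<noteq> {}" "A \<subset> C"
  shows "2 * k - 2 + residue_norm k (\<Sum>v\<in>A. \<gamma> v - n v) \<le> cut_count E tail head A + sum p A"
proof -
  have "\<not> (A = {w} \<and> 2 * k dvd \<gamma> w - n w)" using zero_vertex[OF g] A by auto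
  then show ?thesis by (rule cut_bound[OF g A])
qed

text \<open>Any vertex without required outflow could be taken as the exempted one.\<close>
lemma zero_free:
  assumes g: "guarded k C E tail head \<gamma> n p w" and v: "v \<in> C"
  shows "\<not> 2 * k dvd \<gamma> v - n v"
proof
  assume z: "2 * k dvd \<gamma> v - n v"
  have "guarded k C E tail head \<gamma> n p v"
    using g guarded_all[OF g] unfolding guarded_def by auto
  then show False using zero_vertex v z by blast
qed

text \<open>An empty cut would have to be guarded on both sides by virtual edges, which are too few for that as \<open>k \<ge> 2\<close>.\<close>
lemma connected:
  assumes g: "guarded k C E tail head \<gamma> n p w" and S: "S \<noteq> {}" "S \<subset> C"
  obtains e u x where "e \<in> E" "joins tail head e u x" "u \<in> S" "x \<in> C - S"
proof -
  have S': "C - S \<noteq> {}" "C - S \<subset> C" "S \<subseteq> C" using S by auto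
  have z: "sum p C \<le> 2 * k - 2 + residue_norm k (sum n C)" using g unfolding guarded_def by simp
  have "residue_norm k (sum n C) \<le> residue_norm k (\<Sum>v\<in>S. \<gamma> v - n v) + residue_norm k (\<Sum>v\<in>C - S. \<gamma> v - n v)"
    using residue_norm_add[OF kpos, of "\<Sum>v\<in>S. \<gamma> v - n v" "\<Sum>v\<in>C - S. \<gamma> v - n v"]
      sum.subset_diff[OF S'(3) finC, of "\<lambda>v. \<gamma> v - n v"] total_residue_norm[of n] by (simp add: add.commute)
  moreover have "sum p C = sum p (C - S) + sum p S" by (rule sum.subset_diff[OF S'(3) finC])
  moreover have "cut_count E tail head (C - S) = cut_count E tail head S" by (rule cut_count_compl) (rule ends)
  ultimately have "cut_count E tail head S > 0"
    using guarded_all[OF g S] guarded_all[OF g S'(1,2)] z k2 by linarith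
  then obtain e where e: "e \<in> E" "(tail e \<in> S) \<noteq> (head e \<in> S)" by (rule cut_count_pos)
  show thesis
  proof (cases "tail e \<in> S")
    case True
    then show thesis using that[of e "tail e" "head e"] e ends[OF e(1)] unfolding joins_def by auto
  next
    case False
    then show thesis using that[of e "head e" "tail e"] e ends[OF e(1)] unfolding joins_def by auto
  qed
qed

text \<open>The required outflow reduced to the range from \<open>0\<close> to \<open>2 * k\<close>. A residue below \<open>k\<close> asks for a positive
outflow, one above \<open>k\<close> for a negative outflow, and \<open>k\<close> serves as both.\<close>
definition residue :: "('v \<Rightarrow> int) \<Rightarrow> 'v \<Rightarrow> int" where
  "residue n v = (\<gamma> v - n v) mod (2 * k)"

lemma residue_range:
  assumes "guarded k C E tail head \<gamma> n p w" "v \<in> C"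
  shows "0 < residue n v" "residue n v < 2 * k"
proof -
  have "residue n v \<noteq> 0" using zero_free[OF assms] unfolding residue_def by auto
  moreover have "residue n v \<ge> 0" "residue n v < 2 * k" unfolding residue_def using kpos by auto
  ultimately show "0 < residue n v" "residue n v < 2 * k" by auto
qed

text \<open>Orienting the edge from \<open>u\<close> to \<open>x\<close> brings both ends closer to outflow \<open>0\<close>, so their own cuts remain guarded;
larger sets have slack.\<close>
lemma no_opposite_edge:
  assumes g: "guarded k C E tail head \<gamma> n p w" and e: "e \<in> E" "joins tail head e u x" "u \<noteq> x"
    and r: "residue n u \<le> k" "residue n x \<ge> k"
  shows False
proof -
  have ux: "u \<in> C" "x \<in> C" using ends[OF e(1)] e(2) unfolding joins_def by auto
  let ?g = "\<lambda>v. \<gamma> v - 1 * of_bool (v = u) + 1 * of_bool (v = x)"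
  have "guarded k C (E - {e}) tail head ?g n p w"
    unfolding guarded_def
  proof (intro conjI ballI allI impI)
    fix A assume A: "A \<noteq> {} \<and> A \<subset> C \<and> \<not> (A = {w} \<and> 2 * k dvd ?g w - n w)"
    then have AC: "A \<subseteq> C" by auto
    let ?t = "\<Sum>v\<in>A. \<gamma> v - n v"
    have t: "(\<Sum>v\<in>A. ?g v - n v) = ?t - 1 * of_bool (u \<in> A) + 1 * of_bool (x \<in> A)"
      by (rule shifted_sum[OF AC])
    have b: "cut_count E tail head A = cut_count (E - {e}) tail head A + of_bool ((u \<in> A) \<noteq> (x \<in> A))"
      unfolding cut_count_remove[OF finE e(1)] using e(2) unfolding joins_def by auto
    have base: "2 * k - 2 + residue_norm k ?t \<le> cut_count E tail head A + sum p A" using guarded_all[OF g] A by blast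
    consider (same) "(u \<in> A) = (x \<in> A)" | (u) "A = {u}" | (x) "A = {x}"
      | (big) "(u \<in> A) \<noteq> (x \<in> A)" "card A \<ge> 2"
    proof -
      have "A = {u} \<or> A = {x}" if "(u \<in> A) \<noteq> (x \<in> A)" "\<not> card A \<ge> 2"
        using that finA[OF AC] card_le_Suc0_iff_eq[of A] by auto
      then show thesis using that by blast
    qed
    then show "2 * k - 2 + residue_norm k (\<Sum>v\<in>A. ?g v - n v) \<le> cut_count (E - {e}) tail head A + sum p A"
    proof cases
      case same
      then show ?thesis using base b t by auto
    next
      case u
      have "residue_norm k (\<gamma> u - n u - 1) = residue_norm k (\<gamma> u - n u) - 1"
        by (rule residue_norm_pred[OF kpos]) (use residue_range[OF g ux(1)] r in \<open>auto simp: residue_def\<close>)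
      moreover have eq: "(\<Sum>v\<in>A. ?g v - n v) = \<gamma> u - n u - 1" using t u e(3) by simp
      ultimately have "residue_norm k (\<Sum>v\<in>A. ?g v - n v) = residue_norm k (\<Sum>v\<in>A. \<gamma> v - n v) - 1"
        unfolding eq using u by simp
      moreover have "of_bool ((u \<in> A) \<noteq> (x \<in> A)) = (1 :: int)" using u e(3) by simp
      ultimately show ?thesis using base b by linarith
    next
      case x
      have "residue_norm k (\<gamma> x - n x + 1) = residue_norm k (\<gamma> x - n x) - 1"
        by (rule residue_norm_succ[OF kpos]) (use r in \<open>auto simp: residue_def\<close>)
      moreover have eq: "(\<Sum>v\<in>A. ?g v - n v) = \<gamma> x - n x + 1" using t x e(3) by simp
      ultimately have "residue_norm k (\<Sum>v\<in>A. ?g v - n v) = residue_norm k (\<Sum>v\<in>A. \<gamma> v - n v) - 1"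
        unfolding eq using x by simp
      moreover have "of_bool ((u \<in> A) \<noteq> (x \<in> A)) = (1 :: int)" using x e(3) by simp
      ultimately show ?thesis using base b by linarith
    next
      case big
      then have "2 * k + residue_norm k ?t \<le> cut_count E tail head A + sum p A" using slack[OF g] A by blast
      moreover have "residue_norm k (?t + (- 1 * of_bool (u \<in> A) + 1 * of_bool (x \<in> A))) \<le> residue_norm k ?t + 1"
        using residue_norm_lipschitz[OF kpos, of ?t "- 1 * of_bool (u \<in> A) + 1 * of_bool (x \<in> A)"] big(1) by auto
      ultimately show ?thesis using b t big(1) by auto
    qed
  qed (use g in \<open>auto simp: guarded_def\<close>)
  then show False by (rule no_oriented_deletion[OF e(1,2,3), rotated]) simp
qed

text \<open>Otherwise connectedness yields an edge as in \<open>no_opposite_edge\<close>.\<close>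
lemma same_sign:
  assumes g: "guarded k C E tail head \<gamma> n p w"
  shows "(\<forall>v\<in>C. residue n v < k) \<or> (\<forall>v\<in>C. residue n v > k)"
proof -
  have split: "S = {} \<or> S = C" if S: "S \<subseteq> C"
    and r: "\<And>u x. u \<in> S \<Longrightarrow> x \<in> C - S \<Longrightarrow> residue n u \<le> k \<and> residue n x \<ge> k" for S
  proof (rule ccontr)
    assume "\<not> (S = {} \<or> S = C)"
    then obtain e u x where "e \<in> E" "joins tail head e u x" "u \<in> S" "x \<in> C - S"
      using connected[OF g, of S] S by blast
    then show False using no_opposite_edge[OF g] r by blast
  qed
  have 1: "{v \<in> C. residue n v < k} = {} \<or> {v \<in> C. residue n v < k} = C"
    by (rule split) auto
  have 2: "{v \<in> C. residue n v \<le> k} = {} \<or> {v \<in> C. residue n v \<le> k} = C"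
    by (rule split) auto
  have "\<not> (\<forall>v\<in>C. residue n v = k)"
  proof
    assume k: "\<forall>v\<in>C. residue n v = k"
    obtain v where v: "v \<in> C" using card_C by fastforce
    have "{v} = {} \<or> {v} = C" by (rule split) (use v k in auto)
    then show False using card_C by auto
  qed
  then show ?thesis using 1 2 by force
qed

lemma sum_update:
  fixes f :: "'v \<Rightarrow> int"
  assumes "A \<subseteq> C"
  shows "sum (f(y := f y + c)) A = sum f A + c * of_bool (y \<in> A)"
proof -
  have "sum (f(y := f y + c)) A = (\<Sum>v\<in>A. f v + c * of_bool (v = y))" by (intro sum.cong) auto
  then show ?thesis
    by (simp only: sum.distrib sum_distrib_left[symmetric] sum_of_bool_eq[OF finA[OF assms]])
qed

text \<open>More virtual edges never hurt a cut. Only the bound at the virtual vertex limits how many can be added.\<close>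
lemma add_virtual_edges:
  assumes g: "guarded k C E tail head \<gamma> n p w" and y: "y \<in> C"
    and z: "sum p C + \<bar>d\<bar> \<le> 2 * k - 2 + residue_norm k (sum n C + d)"
  shows "guarded k C E tail head \<gamma> (n(y := n y + d)) (p(y := p y + \<bar>d\<bar>)) w"
proof -
  let ?n = "n(y := n y + d)" and ?p = "p(y := p y + \<bar>d\<bar>)"
  show ?thesis
    unfolding guarded_def
  proof (intro conjI ballI allI impI)
    fix v assume v: "v \<in> C"
    then have "\<bar>n v\<bar> \<le> p v" "even (p v - n v)" using g unfolding guarded_def by auto
    then show "\<bar>?n v\<bar> \<le> ?p v" "even (?p v - ?n v)" by auto
  next
    show "sum ?p C \<le> 2 * k - 2 + residue_norm k (sum ?n C)" using z y by (simp only: sum_update[OF order.refl]) simp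
  next
    fix A assume A: "A \<noteq> {} \<and> A \<subset> C \<and> \<not> (A = {w} \<and> 2 * k dvd \<gamma> w - ?n w)"
    then have AC: "A \<subseteq> C" by auto
    have t: "(\<Sum>v\<in>A. \<gamma> v - ?n v) = (\<Sum>v\<in>A. \<gamma> v - n v) + - (d * of_bool (y \<in> A))"
      unfolding sum_subtractf sum_update[OF AC] by simp
    have "residue_norm k (\<Sum>v\<in>A. \<gamma> v - ?n v) \<le> residue_norm k (\<Sum>v\<in>A. \<gamma> v - n v) + \<bar>- (d * of_bool (y \<in> A))\<bar>"
      unfolding t by (rule residue_norm_lipschitz[OF kpos])
    also have "\<bar>- (d * of_bool (y \<in> A))\<bar> = \<bar>d\<bar> * of_bool (y \<in> A)" by simp
    finally show "2 * k - 2 + residue_norm k (\<Sum>v\<in>A. \<gamma> v - ?n v) \<le> cut_count E tail head A + sum ?p A"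
      using guarded_all[OF g, of A] A unfolding sum_update[OF AC] by linarith
  qed
qed

text \<open>A virtual edge that leaves \<open>y\<close> although \<open>y\<close> still needs positive outflow can be dropped: the requirement of \<open>y\<close>
decreases along with the number of its edges.\<close>
lemma drop_virtual_edge:
  assumes g: "guarded k C E tail head \<gamma> n p w" and y: "y \<in> C" and r: "residue n y \<le> k" and np: "n y < p y"
  shows "guarded k C E tail head \<gamma> (n(y := n y + 1)) (p(y := p y - 1)) w"
proof -
  let ?n = "n(y := n y + 1)" and ?p = "p(y := p y - 1)"
  have sn: "sum ?n A = sum n A + of_bool (y \<in> A)" and sp: "sum ?p A = sum p A - of_bool (y \<in> A)"
    if "A \<subseteq> C" for A
    using sum_update[OF that, where f = n and c = 1] sum_update[OF that, where f = p and c = "- 1"] by simp_all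
  show ?thesis
    unfolding guarded_def
  proof (intro conjI ballI allI impI)
    fix v assume v: "v \<in> C"
    then have *: "\<bar>n v\<bar> \<le> p v" "even (p v - n v)" using g unfolding guarded_def by auto
    have "\<bar>n y\<bar> \<le> p y" "even (p y - n y)" using g y unfolding guarded_def by auto
    then have "\<bar>n y + 1\<bar> \<le> p y - 1" using np by presburger
    then show "\<bar>?n v\<bar> \<le> ?p v" using * by auto
    show "even (?p v - ?n v)" using * by auto
  next
    have "residue_norm k (sum n C) \<le> residue_norm k (sum n C + 1) + 1"
      using residue_norm_lipschitz[OF kpos, of "sum n C + 1" "- 1"] by simp
    moreover have "sum p C \<le> 2 * k - 2 + residue_norm k (sum n C)" using g unfolding guarded_def by simp
    ultimately show "sum ?p C \<le> 2 * k - 2 + residue_norm k (sum ?n C)"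
      using y sn[OF order.refl] sp[OF order.refl] by simp
  next
    fix A assume A: "A \<noteq> {} \<and> A \<subset> C \<and> \<not> (A = {w} \<and> 2 * k dvd \<gamma> w - ?n w)"
    then have AC: "A \<subseteq> C" by auto
    have t: "(\<Sum>v\<in>A. \<gamma> v - ?n v) = (\<Sum>v\<in>A. \<gamma> v - n v) - of_bool (y \<in> A)"
      unfolding sum_subtractf sn[OF AC] by simp
    have base: "2 * k - 2 + residue_norm k (\<Sum>v\<in>A. \<gamma> v - n v) \<le> cut_count E tail head A + sum p A"
      using guarded_all[OF g] A by blast
    consider (out) "y \<notin> A" | (single) "A = {y}" | (big) "y \<in> A" "card A \<ge> 2"
    proof -
      have "A = {y}" if "y \<in> A" "\<not> card A \<ge> 2"
        using that finA[OF AC] card_le_Suc0_iff_eq[of A] by auto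
      then show thesis using that by blast
    qed
    then show "2 * k - 2 + residue_norm k (\<Sum>v\<in>A. \<gamma> v - ?n v) \<le> cut_count E tail head A + sum ?p A"
    proof cases
      case out
      then show ?thesis using base unfolding t sp[OF AC] by simp
    next
      case single
      have "residue_norm k (\<gamma> y - n y - 1) = residue_norm k (\<gamma> y - n y) - 1"
        by (rule residue_norm_pred[OF kpos]) (use residue_range[OF g y] r in \<open>auto simp: residue_def\<close>)
      then have "residue_norm k ((\<Sum>v\<in>A. \<gamma> v - n v) - of_bool (y \<in> A)) = residue_norm k (\<Sum>v\<in>A. \<gamma> v - n v) - 1"
        using single by simp
      then show ?thesis using base single unfolding t sp[OF AC] by auto
    next
      case big
      then have "2 * k + residue_norm k (\<Sum>v\<in>A. \<gamma> v - n v) \<le> cut_count E tail head A + sum p A"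
        using slack[OF g] A by blast
      moreover have "residue_norm k ((\<Sum>v\<in>A. \<gamma> v - n v) - 1) \<le> residue_norm k (\<Sum>v\<in>A. \<gamma> v - n v) + 1"
        using residue_norm_lipschitz[OF kpos, of "\<Sum>v\<in>A. \<gamma> v - n v" "- 1"] by simp
      ultimately show ?thesis using big unfolding t sp[OF AC] by simp
    qed
  qed
qed

text \<open>With fewest virtual edges, all of them enter their vertex, and the bound at the virtual vertex leaves at most
\<open>2 * k - 1\<close>. Take any vertex \<open>y\<close>, with residue \<open>r\<close>. If there is room for \<open>r\<close> more virtual edges into \<open>y\<close>, they
satisfy \<open>y\<close> completely, contrary to \<open>zero_free\<close>. If not, there is room for \<open>k - r\<close> virtual edges out of \<open>y\<close>, because
the outflow of the virtual vertex, now above \<open>k\<close>, moves towards \<open>k\<close> and its norm grows. They increase the residue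
of \<open>y\<close> to \<open>k\<close>, contrary to \<open>same_sign\<close>.\<close>
lemma not_all_residues_low:
  assumes g: "guarded k C E tail head \<gamma> n p w" and low: "\<And>v. v \<in> C \<Longrightarrow> residue n v < k"
    and min: "\<And>n' p' w'. guarded k C E tail head \<gamma> n' p' w' \<Longrightarrow> sum p C \<le> sum p' C"
  shows False
proof -
  have eq: "n v = p v" if v: "v \<in> C" for v
  proof (rule ccontr)
    assume ne: "n v \<noteq> p v"
    have "\<bar>n v\<bar> \<le> p v" using g v unfolding guarded_def by auto
    then have "n v < p v" using ne by simp
    then have "guarded k C E tail head \<gamma> (n(v := n v + 1)) (p(v := p v - 1)) w"
      using drop_virtual_edge[OF g v] low[OF v] by simp
    then have "sum p C \<le> sum (p(v := p v - 1)) C" by (rule min)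
    also have "\<dots> < sum p C"
      by (rule sum_strict_mono_ex1[OF finC]) (use v in auto)
    finally show False by simp
  qed
  define P where "P = sum p C"
  have nP: "sum n C = P" unfolding P_def by (rule sum.cong) (use eq in auto)
  have P0: "P \<ge> 0" unfolding P_def
    by (rule sum_nonneg) (use g in \<open>force simp: guarded_def\<close>)
  have z: "P \<le> 2 * k - 2 + residue_norm k P" using g nP unfolding guarded_def P_def by simp
  have P1: "P \<le> 2 * k - 1"
  proof (rule ccontr)
    assume "\<not> ?thesis"
    then show False using z residue_norm_le[OF kpos, of P "- 1"] by simp
  qed
  obtain y where y: "y \<in> C" using card_C by fastforce
  define r where "r = residue n y"
  have r: "0 < r" "r < k" using residue_range[OF g y] low[OF y] unfolding r_def by auto
  show False
  proof (cases "P + r \<le> 2 * k - 1")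
    case True
    have "P + r \<le> 2 * k - 2 + residue_norm k (P + r)"
      using residue_norm_low[of "P + r" k] residue_norm_high[of k "P + r"] True P0 r k2 by linarith
    then have "guarded k C E tail head \<gamma> (n(y := n y + r)) (p(y := p y + \<bar>r\<bar>)) w"
      using add_virtual_edges[OF g y, of r] nP r unfolding P_def by simp
    moreover have "2 * k dvd \<gamma> y - (n(y := n y + r)) y"
      unfolding r_def residue_def using dvd_minus_mod[of "2 * k" "\<gamma> y - n y"] by (simp add: algebra_simps)
    ultimately show False using zero_free y by blast
  next
    case False
    define d where "d = r - k"
    have "P + \<bar>d\<bar> \<le> 2 * k - 2 + residue_norm k (P + d)"
      using residue_norm_high[of k "P + d"] False P1 r unfolding d_def by simp
    then have g': "guarded k C E tail head \<gamma> (n(y := n y + d)) (p(y := p y + \<bar>d\<bar>)) w"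
      using add_virtual_edges[OF g y, of d] nP unfolding P_def by simp
    have "\<gamma> y - (n(y := n y + d)) y = k + 2 * k * ((\<gamma> y - n y) div (2 * k))"
      using minus_mod_eq_mult_div[of "\<gamma> y - n y" "2 * k"] unfolding d_def r_def residue_def by simp
    then have ry: "residue (n(y := n y + d)) y = k" unfolding residue_def using k2 by simp
    show False using same_sign[OF g'] y ry by force
  qed
qed

end

lemma guarded_minus:
  assumes "k > 0"
  shows "guarded k C E tail head (\<lambda>v. - \<gamma> v) (\<lambda>v. - n v) p w \<longleftrightarrow> guarded k C E tail head \<gamma> n p w"
proof -
  have "(\<Sum>v\<in>A. - \<gamma> v - - n v) = - (\<Sum>v\<in>A. \<gamma> v - n v)" for A
    unfolding sum_negf[symmetric] by (intro sum.cong) auto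
  moreover have "- \<gamma> w - - n w = - (\<gamma> w - n w)" by simp
  ultimately show ?thesis
    unfolding guarded_def using residue_norm_minus[OF assms] by (simp only: sum_negf abs_minus_cancel dvd_minus_iff) auto
qed

lemma boundary_minus: "boundary k C E tail head (\<lambda>v. - \<gamma> v) \<longleftrightarrow> boundary k C E tail head \<gamma>"
proof -
  have "even (- \<gamma> v - b) \<longleftrightarrow> even (\<gamma> v - b)" for v and b :: int by auto
  then show ?thesis unfolding boundary_def by (simp only: sum_negf dvd_minus_iff)
qed

lemma orientable_minus:
  assumes "orientable k C E tail head \<gamma>"
  shows "orientable k C E tail head (\<lambda>v. - \<gamma> v)"
proof -
  obtain \<sigma> where s: "sign_valued \<sigma>" "\<And>v. v \<in> C \<Longrightarrow> 2 * k dvd \<gamma> v - net_outflow E tail head \<sigma> v"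
    using assms unfolding orientable_def by blast
  have "sign_valued (\<lambda>e. - \<sigma> e)" using s(1) unfolding sign_valued_def by force
  moreover have "2 * k dvd - \<gamma> v - net_outflow E tail head (\<lambda>e. - \<sigma> e) v" if "v \<in> C" for v
  proof -
    have "net_outflow E tail head (\<lambda>e. - \<sigma> e) v = - net_outflow E tail head \<sigma> v"
      unfolding net_outflow_def by (simp add: sum_negf)
    then have "- \<gamma> v - net_outflow E tail head (\<lambda>e. - \<sigma> e) v = - (\<gamma> v - net_outflow E tail head \<sigma> v)" by simp
    then show ?thesis using s(2)[OF that] by (simp only: dvd_minus_iff)
  qed
  ultimately show ?thesis unfolding orientable_def by blast
qed

text \<open>In a smallest counterexample with fewest virtual edges all residues lie on one side of \<open>k\<close>. Reversing all directions
exchanges the two sides.\<close>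
theorem guarded_orientable:
  fixes C :: "'v set" and E :: "'e set"
  assumes "k \<ge> 2" "boundary k C E tail head \<gamma>" "guarded k C E tail head \<gamma> n p w"
  shows "orientable k C E tail head \<gamma>"
  using assms(2,3)
proof (induction "card C + card E" arbitrary: C E tail head \<gamma> n p w rule: less_induct)
  case less
  show ?case
  proof (rule ccontr)
    assume stuck: "\<not> orientable k C E tail head \<gamma>"
    have crit: "critical k C E tail head \<gamma>"
      by unfold_locales (use assms(1) less stuck in auto)
    have crit': "critical k C E tail head (\<lambda>v. - \<gamma> v)"
    proof unfold_locales
      show "\<not> orientable k C E tail head (\<lambda>v. - \<gamma> v)" using orientable_minus[of k C E tail head "\<lambda>v. - \<gamma> v"] stuck by auto
      show "boundary k C E tail head (\<lambda>v. - \<gamma> v)" using less.prems boundary_minus by blast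
    qed (use assms(1) less in auto)
    have kpos: "k > 0" using assms(1) by simp
    obtain n p w where g: "guarded k C E tail head \<gamma> n p w"
      and min: "\<And>n' p' w'. guarded k C E tail head \<gamma> n' p' w' \<Longrightarrow> nat (sum p C) \<le> nat (sum p' C)"
    proof -
      define Q where "Q = (\<lambda>(n, p, w). guarded k C E tail head \<gamma> n p w)"
      have "Q (n, p, w)" using less.prems unfolding Q_def by simp
      then obtain x where x: "Q x" "\<And>y. Q y \<Longrightarrow> (\<lambda>(n, p, w). nat (sum p C)) x \<le> (\<lambda>(n, p, w). nat (sum p C)) y"
        using ex_has_least_nat[of Q "(n, p, w)" "\<lambda>(n, p, w). nat (sum p C)"] by blast
      obtain a b c where abc: "x = (a, b, c)" by (cases x)
      have "guarded k C E tail head \<gamma> a b c" using x(1) unfolding Q_def abc by simp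
      moreover have "nat (sum b C) \<le> nat (sum p' C)" if "guarded k C E tail head \<gamma> n' p' w'" for n' p' w'
        using x(2)[of "(n', p', w')"] that unfolding Q_def abc by simp
      ultimately show thesis by (rule that)
    qed
    have pos: "sum p C \<ge> 0" if "guarded k C E tail head \<gamma> n p w" for n p w
      by (rule sum_nonneg) (use that in \<open>force simp: guarded_def\<close>)
    have min': "sum p C \<le> sum p' C" if g': "guarded k C E tail head \<gamma> n' p' w'" for n' p' w'
      using min[OF g'] pos[OF g'] pos[OF g] by linarith
    show False
    proof (cases "\<forall>v\<in>C. critical.residue k \<gamma> n v < k")
      case True
      then show False using critical.not_all_residues_low[OF crit g] min' by blast
    next
      case False
      then have high: "\<And>v. v \<in> C \<Longrightarrow> critical.residue k \<gamma> n v > k" using critical.same_sign[OF crit g] by blast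
      have g': "guarded k C E tail head (\<lambda>v. - \<gamma> v) (\<lambda>v. - n v) p w" by (rule iffD2[OF guarded_minus[OF kpos] g])
      show False
      proof (rule critical.not_all_residues_low[OF crit' g'])
        fix v assume v: "v \<in> C"
        have "(- (\<gamma> v - n v)) mod (2 * k) = 2 * k - (\<gamma> v - n v) mod (2 * k)"
          using high[OF v] kpos unfolding critical.residue_def[OF crit] by (subst zmod_zminus1_eq_if) auto
        then show "critical.residue k (\<lambda>v. - \<gamma> v) (\<lambda>v. - n v) v < k"
          using high[OF v] unfolding critical.residue_def[OF crit] critical.residue_def[OF crit'] by simp
      next
        fix n' p' w' assume "guarded k C E tail head (\<lambda>v. - \<gamma> v) n' p' w'"
        then have "guarded k C E tail head \<gamma> (\<lambda>v. - n' v) p' w'"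
          using guarded_minus[OF kpos, of C E tail head \<gamma> "\<lambda>v. - n' v" p' w'] by simp
        then show "sum p C \<le> sum p' C" by (rule min')
      qed
    qed
  qed
qed

section \<open>Orientations with prescribed out-degrees modulo k\<close>

lemma card_eq_sum: "finite E \<Longrightarrow> int (card {e \<in> E. P e}) = (\<Sum>e\<in>E. of_bool (P e))"
  by (simp add: Int_def)

text \<open>Without virtual edges a cut with at least \<open>3 * k - 3\<close> edges is guarded, because the norm is at most \<open>k\<close>, and
if it equals \<open>k\<close> the cut has the parity of \<open>k\<close> and hence at least \<open>3 * k - 2\<close> edges.\<close>
theorem modular_orientation:
  fixes C :: "'v set" and E :: "'e set" and k :: nat
  assumes k: "k \<ge> 1" and fin: "finite C" "finite E" and ends: "\<And>e. e \<in> E \<Longrightarrow> tail e \<in> C \<and> head e \<in> C"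
    and conn: "\<And>A. A \<noteq> {} \<Longrightarrow> A \<subset> C \<Longrightarrow> 3 * int k - 3 \<le> cut_count E tail head A"
    and f: "int k dvd sum f C - int (card E)"
  shows "\<exists>src dst. (\<forall>e. src e = tail e \<and> dst e = head e \<or> src e = head e \<and> dst e = tail e) \<and>
    (\<forall>v\<in>C. int k dvd int (card {e \<in> E. src e = v}) - f v)"
proof (cases "k = 1")
  case True
  then show ?thesis by (intro exI[of _ tail] exI[of _ head]) auto
next
  case False
  with k have k2: "int k \<ge> 2" by simp
  \<comment> \<open>twice the out-degree is the degree plus the net outflow\<close>
  define \<gamma> where "\<gamma> v = 2 * f v - (\<Sum>e\<in>E. of_bool (tail e = v) + of_bool (head e = v))" for v
  have par: "even (\<gamma> v - cut_count E tail head {v})" for v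
  proof -
    have "even (\<Sum>e\<in>E. (of_bool (tail e = v) + of_bool (head e = v)) - of_bool ((tail e \<in> {v}) \<noteq> (head e \<in> {v})) :: int)"
      by (rule dvd_sum) auto
    then show ?thesis unfolding \<gamma>_def cut_count_def by (simp add: sum_subtractf)
  qed
  have "(\<Sum>v\<in>C. \<Sum>e\<in>E. of_bool (tail e = v) + of_bool (head e = v))
      = (\<Sum>e\<in>E. \<Sum>v\<in>C. of_bool (v = tail e) + of_bool (v = head e) :: int)"
    by (subst sum.swap) (simp add: eq_commute)
  also have "\<dots> = (\<Sum>e\<in>E. 2)"
    by (rule sum.cong) (use ends in \<open>simp_all add: sum.distrib sum_of_bool_eq[OF fin(1)]\<close>)
  finally have "sum \<gamma> C = 2 * (sum f C - int (card E))"
    unfolding \<gamma>_def by (simp add: sum_subtractf sum_distrib_left)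
  then have tot: "2 * int k dvd sum \<gamma> C" using mult_dvd_mono[OF dvd_refl[of 2] f] by metis
  have bd: "boundary (int k) C E tail head \<gamma>" unfolding boundary_def using fin ends tot par by auto
  have "guarded (int k) C E tail head \<gamma> (\<lambda>_. 0) (\<lambda>_. 0) w" for w
    unfolding guarded_def
  proof (intro conjI ballI allI impI)
    fix A assume A: "A \<noteq> {} \<and> A \<subset> C \<and> \<not> (A = {w} \<and> 2 * int k dvd \<gamma> w - 0)"
    have c: "3 * int k - 3 \<le> cut_count E tail head A" using conn A by blast
    have "even (sum \<gamma> A - cut_count E tail head A)" using even_sum_boundary[OF bd, of A] A by blast
    moreover have "even (residue_norm (int k) (sum \<gamma> A) - sum \<gamma> A)" by (rule residue_norm_parity) (use k2 in simp)
    ultimately have "even (cut_count E tail head A - residue_norm (int k) (sum \<gamma> A))" by presburger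
    moreover have "residue_norm (int k) (sum \<gamma> A) \<le> int k" by (rule residue_norm_le_k)
    ultimately have "2 * int k - 2 + residue_norm (int k) (sum \<gamma> A) \<le> cut_count E tail head A" using c k2 by presburger
    then show "2 * int k - 2 + residue_norm (int k) (\<Sum>v\<in>A. \<gamma> v - 0) \<le> cut_count E tail head A + sum (\<lambda>_. 0) A" by simp
  qed (use k2 residue_norm_nonneg[of "int k" 0] in auto)
  then have "orientable (int k) C E tail head \<gamma>" using guarded_orientable[OF k2 bd] by blast
  then obtain \<sigma> where s: "sign_valued \<sigma>" and o: "\<And>v. v \<in> C \<Longrightarrow> 2 * int k dvd \<gamma> v - net_outflow E tail head \<sigma> v"
    unfolding orientable_def by blast
  define src where "src e = (if \<sigma> e = 1 then tail e else head e)" for e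
  define dst where "dst e = (if \<sigma> e = 1 then head e else tail e)" for e
  have "int k dvd int (card {e \<in> E. src e = v}) - f v" if v: "v \<in> C" for v
  proof -
    have "2 * of_bool (src e = v) = of_bool (tail e = v) + of_bool (head e = v)
        + \<sigma> e * (of_bool (tail e = v) - of_bool (head e = v))" for e
      using s unfolding sign_valued_def src_def by (cases "\<sigma> e = 1") (auto simp: spec[of _ e])
    then have "(\<Sum>e\<in>E. 2 * of_bool (src e = v)) = (\<Sum>e\<in>E. of_bool (tail e = v) + of_bool (head e = v))
        + net_outflow E tail head \<sigma> v"
      unfolding net_outflow_def by (simp only: sum.distrib)
    then have "2 * int (card {e \<in> E. src e = v}) = 2 * f v - (\<gamma> v - net_outflow E tail head \<sigma> v)"
      unfolding card_eq_sum[OF fin(2)] \<gamma>_def sum_distrib_left[symmetric] by simp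
    then have "2 * (int (card {e \<in> E. src e = v}) - f v) = - (\<gamma> v - net_outflow E tail head \<sigma> v)" by simp
    then have "2 * int k dvd 2 * (int (card {e \<in> E. src e = v}) - f v)" using o[OF v] by (simp only: dvd_minus_iff)
    then show ?thesis by (simp only: dvd_mult_cancel_left) simp
  qed
  then show ?thesis by (intro exI[of _ src] exI[of _ dst]) (auto simp: src_def dst_def)
qed

section \<open>Equitable edge colourings\<close>

definition class_count :: "'e set \<Rightarrow> ('e \<Rightarrow> 'v) \<Rightarrow> ('e \<Rightarrow> nat) \<Rightarrow> 'v \<Rightarrow> nat \<Rightarrow> nat" where
  "class_count E f c v i = card {e \<in> E. f e = v \<and> c e = i}"

lemma sum_class_count:
  assumes "finite E" "\<forall>e\<in>E. c e < k"
  shows "(\<Sum>i<k. class_count E f c v i) = card {e \<in> E. f e = v}"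
proof -
  have "{e \<in> E. f e = v} = (\<Union>i\<in>{..<k}. {e \<in> E. f e = v \<and> c e = i})" using assms(2) by auto
  moreover have "card (\<Union>i\<in>{..<k}. {e \<in> E. f e = v \<and> c e = i}) = (\<Sum>i<k. card {e \<in> E. f e = v \<and> c e = i})"
    by (rule card_UN_disjoint) (use assms(1) in auto)
  ultimately show ?thesis unfolding class_count_def by simp
qed

lemma squares_le:
  fixes a b a' b' :: nat
  assumes "a' + b' = a + b" "\<bar>int a' - int b'\<bar> \<le> 1"
  shows "a'\<^sup>2 + b'\<^sup>2 \<le> a\<^sup>2 + b\<^sup>2" and "a \<ge> b + 2 \<Longrightarrow> a'\<^sup>2 + b'\<^sup>2 < a\<^sup>2 + b\<^sup>2"
proof -
  let ?d = "int a - int b" and ?d' = "int a' - int b'"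
  have id: "2 * (int x ^ 2 + int y ^ 2) = (int x + int y) ^ 2 + (int x - int y) ^ 2" for x y
    by (simp add: power2_eq_square algebra_simps)
  have s: "int a' + int b' = int a + int b" using assms(1) by linarith
  have par: "even (?d' - ?d)" using s by presburger
  have le: "\<bar>?d'\<bar> \<le> \<bar>?d\<bar>" using par assms(2) by presburger
  then have "?d' ^ 2 \<le> ?d ^ 2" by (simp add: abs_le_square_iff)
  then have "2 * (int a' ^ 2 + int b' ^ 2) \<le> 2 * (int a ^ 2 + int b ^ 2)" unfolding id s by (rule add_left_mono)
  then have "int a' ^ 2 + int b' ^ 2 \<le> int a ^ 2 + int b ^ 2" by simp
  then show "a'\<^sup>2 + b'\<^sup>2 \<le> a\<^sup>2 + b\<^sup>2"
    using of_nat_le_iff[of "a'\<^sup>2 + b'\<^sup>2" "a\<^sup>2 + b\<^sup>2", where ?'a = int] by simp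
  assume "a \<ge> b + 2"
  then have "\<bar>?d'\<bar> < \<bar>?d\<bar>" using assms(2) by linarith
  then have "?d' ^ 2 < ?d ^ 2" by (meson abs_le_square_iff linorder_not_le)
  then have "2 * (int a' ^ 2 + int b' ^ 2) < 2 * (int a ^ 2 + int b ^ 2)" unfolding id s by (rule add_strict_left_mono)
  then have "int a' ^ 2 + int b' ^ 2 < int a ^ 2 + int b ^ 2" by simp
  then show "a'\<^sup>2 + b'\<^sup>2 < a\<^sup>2 + b\<^sup>2"
    using of_nat_less_iff[of "a'\<^sup>2 + b'\<^sup>2" "a\<^sup>2 + b\<^sup>2", where ?'a = int] by simp
qed

text \<open>The edges of two colours form a bipartite graph between out-ends and in-ends. A balanced orientation of it
redistributes the two colours so that they differ by at most one at every end; this lowers the sum of squares wherever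
they differed by more.\<close>
lemma rebalance:
  fixes c :: "'e \<Rightarrow> nat"
  assumes fin: "finite E" and ij: "i < k" "j < k" "i \<noteq> j" and c: "\<forall>e\<in>E. c e < k"
  shows "\<exists>c'. (\<forall>e\<in>E. c' e < k) \<and>
    (\<forall>f v. f = src \<or> f = dst \<longrightarrow> (\<Sum>l<k. (class_count E f c' v l)\<^sup>2) \<le> (\<Sum>l<k. (class_count E f c v l)\<^sup>2) \<and>
      (class_count E f c v i \<ge> class_count E f c v j + 2 \<longrightarrow>
        (\<Sum>l<k. (class_count E f c' v l)\<^sup>2) < (\<Sum>l<k. (class_count E f c v l)\<^sup>2)))"
proof -
  \<comment> \<open>the ends are separated into \<open>Inl\<close> and \<open>Inr\<close>, so every edge leaves an out-end or an in-end according to its sign\<close>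
  define D where "D = {e \<in> E. c e = i \<or> c e = j}"
  have fD: "finite D" using fin unfolding D_def by simp
  obtain \<sigma> where s: "sign_valued \<sigma>" and bal: "\<And>v. \<bar>net_outflow D (Inl \<circ> src) (Inr \<circ> dst) \<sigma> v\<bar> \<le> 1"
    using balanced_orientation[OF fD, of "Inl \<circ> src" "Inr \<circ> dst"] by blast
  define c' where "c' e = (if e \<in> D then if \<sigma> e = 1 then i else j else c e)" for e
  have c'k: "c' e < k" if "e \<in> E" for e using c that ij unfolding c'_def by auto
  have other: "class_count E f c' v l = class_count E f c v l" if "l \<noteq> i" "l \<noteq> j" for f :: "'e \<Rightarrow> 'a" and v l
  proof -
    have "{e \<in> E. f e = v \<and> c' e = l} = {e \<in> E. f e = v \<and> c e = l}"
      using that unfolding c'_def D_def by auto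
    then show ?thesis unfolding class_count_def by simp
  qed
  have tot: "class_count E f c' v i + class_count E f c' v j = class_count E f c v i + class_count E f c v j" for f :: "'e \<Rightarrow> 'a" and v
  proof -
    have "class_count E f c'' v i + class_count E f c'' v j = card ({e \<in> E. f e = v \<and> c'' e = i} \<union> {e \<in> E. f e = v \<and> c'' e = j})"
      for c'' :: "'e \<Rightarrow> nat"
      unfolding class_count_def by (rule card_Un_disjoint[symmetric]) (use fin ij in auto)
    moreover have "{e \<in> E. f e = v \<and> c' e = i} \<union> {e \<in> E. f e = v \<and> c' e = j}
      = {e \<in> E. f e = v \<and> c e = i} \<union> {e \<in> E. f e = v \<and> c e = j}"
      unfolding c'_def D_def by auto
    ultimately show ?thesis by simp
  qed
  have diff: "\<bar>int (class_count E f c' v i) - int (class_count E f c' v j)\<bar> \<le> 1" if f: "f = src \<or> f = dst" for f v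
  proof -
    have "int (class_count E f c' v i) - int (class_count E f c' v j) = (\<Sum>e\<in>D. \<sigma> e * of_bool (f e = v))"
    proof -
      have sets: "{e \<in> E. f e = v \<and> c' e = i} = {e \<in> D. f e = v \<and> \<sigma> e = 1}"
        "{e \<in> E. f e = v \<and> c' e = j} = {e \<in> D. f e = v \<and> \<sigma> e \<noteq> 1}"
        using ij(3) unfolding c'_def D_def by auto
      have "int (class_count E f c' v i) - int (class_count E f c' v j)
        = (\<Sum>e\<in>D. of_bool (f e = v \<and> \<sigma> e = 1) - of_bool (f e = v \<and> \<sigma> e \<noteq> 1))"
        unfolding class_count_def sets card_eq_sum[OF fD] sum_subtractf ..
      also have "\<dots> = (\<Sum>e\<in>D. \<sigma> e * of_bool (f e = v))"
        by (rule sum.cong[OF refl]) (use s in \<open>auto simp: sign_valued_def split: if_splits\<close>)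
      finally show ?thesis .
    qed
    moreover have "(\<Sum>e\<in>D. \<sigma> e * of_bool (src e = v)) = net_outflow D (Inl \<circ> src) (Inr \<circ> dst) \<sigma> (Inl v)"
      unfolding net_outflow_def by (intro sum.cong) auto
    moreover have "(\<Sum>e\<in>D. \<sigma> e * of_bool (dst e = v)) = - net_outflow D (Inl \<circ> src) (Inr \<circ> dst) \<sigma> (Inr v)"
      unfolding net_outflow_def sum_negf[symmetric] by (intro sum.cong) auto
    ultimately show ?thesis using f bal[of "Inl v"] bal[of "Inr v"] by auto
  qed
  have split: "(\<Sum>l<k. (class_count E f c'' v l)\<^sup>2) = ((class_count E f c'' v i)\<^sup>2 + (class_count E f c'' v j)\<^sup>2)
      + (\<Sum>l\<in>{..<k} - {i} - {j}. (class_count E f c'' v l)\<^sup>2)" for f :: "'e \<Rightarrow> 'a" and v c''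
    using ij sum.remove[of "{..<k}" i "\<lambda>l. (class_count E f c'' v l)\<^sup>2"]
      sum.remove[of "{..<k} - {i}" j "\<lambda>l. (class_count E f c'' v l)\<^sup>2"] by simp
  have rest: "(\<Sum>l\<in>{..<k} - {i} - {j}. (class_count E f c' v l)\<^sup>2) = (\<Sum>l\<in>{..<k} - {i} - {j}. (class_count E f c v l)\<^sup>2)"
    for f :: "'e \<Rightarrow> 'a" and v by (rule sum.cong) (use other in auto)
  show ?thesis
  proof (intro exI[of _ c'] conjI ballI allI impI)
    fix f v assume f: "f = src \<or> f = dst"
    show "(\<Sum>l<k. (class_count E f c' v l)\<^sup>2) \<le> (\<Sum>l<k. (class_count E f c v l)\<^sup>2)"
      unfolding split rest using squares_le(1)[OF tot diff[OF f]] by simp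
    assume "class_count E f c v i \<ge> class_count E f c v j + 2"
    then show "(\<Sum>l<k. (class_count E f c' v l)\<^sup>2) < (\<Sum>l<k. (class_count E f c v l)\<^sup>2)"
      unfolding split rest using squares_le(2)[OF tot diff[OF f]] by simp
  qed (rule c'k)
qed

text \<open>A colouring with the least sum of squared class sizes over all out-ends and in-ends is equitable.\<close>
theorem equitable_colouring:
  assumes fin: "finite E" and k: "k \<ge> 1"
  shows "\<exists>c :: 'e \<Rightarrow> nat. (\<forall>e\<in>E. c e < k) \<and>
    (\<forall>f v i j. f = src \<or> f = dst \<longrightarrow> i < k \<longrightarrow> j < k \<longrightarrow> class_count E f c v i \<le> class_count E f c v j + 1)"
proof -
  define \<Phi> where "\<Phi> c = (\<Sum>v\<in>src ` E. \<Sum>l<k. (class_count E src c v l)\<^sup>2) + (\<Sum>v\<in>dst ` E. \<Sum>l<k. (class_count E dst c v l)\<^sup>2)"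
    for c
  obtain c where c: "\<forall>e\<in>E. c e < k" and min: "\<And>c'. \<forall>e\<in>E. c' e < k \<Longrightarrow> \<Phi> c \<le> \<Phi> c'"
    using ex_has_least_nat[of "\<lambda>c. \<forall>e\<in>E. c e < k" "\<lambda>_. 0" \<Phi>] k by auto
  have "class_count E f c v i \<le> class_count E f c v j + 1" if f: "f = src \<or> f = dst" and ij: "i < k" "j < k" for f v i j
  proof (rule ccontr)
    assume "\<not> ?thesis"
    then have gt: "class_count E f c v i \<ge> class_count E f c v j + 2" by simp
    then have ne: "i \<noteq> j" by auto
    obtain c' where c': "\<forall>e\<in>E. c' e < k"
      and drop: "\<forall>f v. f = src \<or> f = dst \<longrightarrow> (\<Sum>l<k. (class_count E f c' v l)\<^sup>2) \<le> (\<Sum>l<k. (class_count E f c v l)\<^sup>2) \<and>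
        (class_count E f c v i \<ge> class_count E f c v j + 2 \<longrightarrow>
          (\<Sum>l<k. (class_count E f c' v l)\<^sup>2) < (\<Sum>l<k. (class_count E f c v l)\<^sup>2))"
      using rebalance[OF fin ij ne c, of src dst] by (elim exE conjE)
    have le: "(\<Sum>l<k. (class_count E f c' v l)\<^sup>2) \<le> (\<Sum>l<k. (class_count E f c v l)\<^sup>2)" if "f = src \<or> f = dst" for f v
      using drop[THEN spec[of _ f], THEN spec[of _ v], THEN mp, OF that] by (rule conjunct1)
    have less: "(\<Sum>l<k. (class_count E f c' v l)\<^sup>2) < (\<Sum>l<k. (class_count E f c v l)\<^sup>2)"
      using drop[THEN spec[of _ f], THEN spec[of _ v], THEN mp, OF f, THEN conjunct2, THEN mp, OF gt] .
    have "{e \<in> E. f e = v \<and> c e = i} \<noteq> {}" using gt unfolding class_count_def by (intro notI) simp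
    then have v: "v \<in> f ` E" by auto
    have mono: "(\<Sum>v\<in>f' ` E. \<Sum>l<k. (class_count E f' c' v l)\<^sup>2) \<le> (\<Sum>v\<in>f' ` E. \<Sum>l<k. (class_count E f' c v l)\<^sup>2)"
      if "f' = src \<or> f' = dst" for f' by (rule sum_mono) (rule le[OF that])
    have strict: "(\<Sum>v\<in>f ` E. \<Sum>l<k. (class_count E f c' v l)\<^sup>2) < (\<Sum>v\<in>f ` E. \<Sum>l<k. (class_count E f c v l)\<^sup>2)"
      by (rule sum_strict_mono_ex1) (use fin le[OF f] less v in auto)
    have "\<Phi> c' < \<Phi> c" using f strict mono[of src] mono[of dst] unfolding \<Phi>_def by auto
    moreover have "\<Phi> c \<le> \<Phi> c'" by (rule min[OF c'])
    ultimately show False by simp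
  qed
  then show ?thesis by (intro exI[of _ c] conjI c) simp
qed

lemma equitable_le:
  fixes g :: "nat \<Rightarrow> nat"
  assumes eq: "\<And>i j. i < k \<Longrightarrow> j < k \<Longrightarrow> g i \<le> g j + 1" and s: "sum g {..<k} \<le> k * a" and i: "i < k"
  shows "g i \<le> a"
proof (rule ccontr)
  assume "\<not> ?thesis"
  then have gi: "a < g i" by simp
  then have "a \<le> g j" if "j < k" for j using eq[OF i that] by simp
  then have "(\<Sum>j<k. a) < sum g {..<k}"
    by (intro sum_strict_mono_ex1) (use i gi in auto)
  then show False using s by simp
qed

lemma equitable_values:
  fixes g :: "nat \<Rightarrow> nat"
  assumes eq: "\<And>i j. i < k \<Longrightarrow> j < k \<Longrightarrow> g i \<le> g j + 1" and s: "sum g {..<k} = k * a + r" and r: "r < k"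
  shows "\<And>i. i < k \<Longrightarrow> g i = a \<or> g i = a + 1" and "card {i. i < k \<and> g i = a + 1} = r"
proof -
  show val: "g i = a \<or> g i = a + 1" if i: "i < k" for i
  proof -
    have "g i \<le> a + 1" by (rule equitable_le[OF eq _ i]) (use s r in auto)
    moreover have "a \<le> g i"
    proof (rule ccontr)
      assume "\<not> a \<le> g i"
      then have gi: "g i < a" by simp
      then have "g j \<le> a" if "j < k" for j using eq[OF that i] by simp
      then have "sum g {..<k} < (\<Sum>j<k. a)"
        by (intro sum_strict_mono_ex1) (use i gi in auto)
      then show False using s by simp
    qed
    ultimately show ?thesis by auto
  qed
  have "sum g {..<k} = (\<Sum>i<k. a + of_bool (g i = a + 1))"
    by (rule sum.cong) (use val in fastforce)+
  also have "\<dots> = k * a + card {i. i < k \<and> g i = a + 1}"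
    by (simp add: sum.distrib Int_def)
  finally show "card {i. i < k \<and> g i = a + 1} = r" using s by simp
qed

section \<open>Degrees and factors with even bounds\<close>

definition vertex_degree :: "'e set \<Rightarrow> ('e \<Rightarrow> 'v) \<Rightarrow> ('e \<Rightarrow> 'v) \<Rightarrow> 'v \<Rightarrow> nat" where
  "vertex_degree E tail head v = card {e \<in> E. tail e = v} + card {e \<in> E. head e = v}"

lemma vertex_degree_eq_sum:
  assumes "finite E"
  shows "int (vertex_degree E tail head v) = (\<Sum>e\<in>E. of_bool (tail e = v) + of_bool (head e = v))"
proof -
  have "int (vertex_degree E tail head v) = int (card {e \<in> E. tail e = v}) + int (card {e \<in> E. head e = v})"
    unfolding vertex_degree_def by simp
  also have "\<dots> = (\<Sum>e\<in>E. of_bool (tail e = v)) + (\<Sum>e\<in>E. of_bool (head e = v))"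
    by (simp only: card_eq_sum[OF assms])
  finally show ?thesis by (simp only: sum.distrib)
qed

lemma vertex_degree_orient:
  assumes "finite E" "\<And>e. e \<in> E \<Longrightarrow> src e = tail e \<and> dst e = head e \<or> src e = head e \<and> dst e = tail e"
  shows "vertex_degree E src dst v = vertex_degree E tail head v"
proof -
  have "int (vertex_degree E src dst v) = int (vertex_degree E tail head v)"
    unfolding vertex_degree_eq_sum[OF assms(1)]
  proof (rule sum.cong[OF refl])
    fix e assume "e \<in> E"
    from assms(2)[OF this]
    show "of_bool (src e = v) + of_bool (dst e = v) = (of_bool (tail e = v) + of_bool (head e = v) :: int)"
      by (elim disjE conjE) (simp_all only: add.commute)
  qed
  then show ?thesis by simp
qed

lemma vertex_degree_colour: "vertex_degree {e \<in> E. c e = i} src dst v = class_count E src c v i + class_count E dst c v i"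
  unfolding vertex_degree_def class_count_def by (simp add: conj_ac)

lemma handshake:
  assumes "finite V" "finite E" "\<And>e. e \<in> E \<Longrightarrow> tail e \<in> V \<and> head e \<in> V"
  shows "(\<Sum>v\<in>V. vertex_degree E tail head v) = 2 * card E"
proof -
  have "int (\<Sum>v\<in>V. vertex_degree E tail head v) = (\<Sum>v\<in>V. \<Sum>e\<in>E. of_bool (tail e = v) + of_bool (head e = v))"
    by (simp only: of_nat_sum vertex_degree_eq_sum[OF assms(2)])
  also have "\<dots> = (\<Sum>e\<in>E. \<Sum>v\<in>V. of_bool (v = tail e) + of_bool (v = head e))"
    by (subst sum.swap) (simp add: eq_commute)
  also have "\<dots> = (\<Sum>e\<in>E. 2)"
    by (rule sum.cong) (use assms(3) in \<open>simp_all add: sum.distrib sum_of_bool_eq[OF assms(1)]\<close>)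
  also have "\<dots> = int (2 * card E)" by simp
  finally show ?thesis by (simp only: of_nat_eq_iff)
qed

text \<open>Consecutive blocks of lengths \<open>a i\<close>.\<close>
lemma block_map:
  assumes "finite I"
  shows "\<exists>g. (\<forall>j < sum a I. g j \<in> I) \<and> (\<forall>i\<in>I. card {j. j < sum a I \<and> g j = i} = (a i :: nat))"
  using assms
proof (induction I)
  case empty
  then show ?case by simp
next
  case (insert x I)
  then obtain g where g: "\<forall>j < sum a I. g j \<in> I" "\<forall>i\<in>I. card {j. j < sum a I \<and> g j = i} = a i" by blast
  define g' where "g' j = (if j < sum a I then g j else x)" for j
  have s: "sum a (insert x I) = a x + sum a I" using insert by simp
  have "card {j. j < sum a (insert x I) \<and> g' j = i} = a i" if i: "i \<in> insert x I" for i
  proof (cases "i = x")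
    case True
    have "{j. j < sum a (insert x I) \<and> g' j = i} = {sum a I..<sum a I + a x}"
      using g(1) insert(2) True unfolding s g'_def by (auto simp flip: not_less)
    then show ?thesis using True by simp
  next
    case False
    then have "{j. j < sum a (insert x I) \<and> g' j = i} = {j. j < sum a I \<and> g j = i}"
      unfolding s g'_def by auto
    then show ?thesis using g(2) i False by simp
  qed
  moreover have "\<forall>j < sum a (insert x I). g' j \<in> insert x I" using g(1) unfolding g'_def by auto
  ultimately show ?case by blast
qed

text \<open>A balanced orientation has in- and out-degrees at most \<open>q = sum a I\<close>. An equitable colouring with \<open>q\<close> colours then uses each
colour at most once at each out-end and in-end, so every colour has degree at most \<open>2\<close>, and \<open>a i\<close> colours
together have degree at most \<open>2 * a i\<close>.\<close>
theorem even_factors: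
  assumes fin: "finite E" "finite I" and d: "\<And>v. vertex_degree E tail head v \<le> 2 * sum a I"
  shows "\<exists>c. (\<forall>e\<in>E. c e \<in> I) \<and> (\<forall>i\<in>I. \<forall>v. vertex_degree {e \<in> E. c e = i} tail head v \<le> 2 * a i)"
proof (cases "sum a I = 0")
  case True
  have "E = {}"
  proof (rule ccontr)
    assume "E \<noteq> {}"
    then obtain e where "e \<in> E" by blast
    then have "card {e' \<in> E. tail e' = tail e} > 0" using fin by (auto simp: card_gt_0_iff)
    then show False using d[of "tail e"] True unfolding vertex_degree_def by simp
  qed
  then show ?thesis by (simp add: vertex_degree_def)
next
  case False
  define q where "q = sum a I"
  have q: "q \<ge> 1" using False unfolding q_def by simp
  obtain \<sigma> where s: "sign_valued \<sigma>" and bal: "\<And>v. \<bar>net_outflow E tail head \<sigma> v\<bar> \<le> 1"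
    using balanced_orientation[OF fin(1)] by blast
  define src where "src e = (if \<sigma> e = 1 then tail e else head e)" for e
  define dst where "dst e = (if \<sigma> e = 1 then head e else tail e)" for e
  have or: "src e = tail e \<and> dst e = head e \<or> src e = head e \<and> dst e = tail e" for e
    unfolding src_def dst_def by auto
  have half: "card {e \<in> E. src e = v} \<le> q \<and> card {e \<in> E. dst e = v} \<le> q" for v
  proof -
    have "net_outflow E tail head \<sigma> v = int (card {e \<in> E. src e = v}) - int (card {e \<in> E. dst e = v})"
      unfolding card_eq_sum[OF fin(1)] net_outflow_def sum_subtractf[symmetric]
      by (rule sum.cong) (use s in \<open>auto simp: sign_valued_def src_def dst_def split: if_splits\<close>)
    moreover have "vertex_degree E src dst v \<le> 2 * q" using vertex_degree_orient[OF fin(1), of src tail dst head] or d unfolding q_def by simp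
    ultimately show ?thesis using bal[of v] unfolding vertex_degree_def by linarith
  qed
  obtain c where c': "\<forall>e\<in>E. c e < q"
    and eq': "\<forall>f v i j. f = src \<or> f = dst \<longrightarrow> i < q \<longrightarrow> j < q \<longrightarrow> class_count E f c v i \<le> class_count E f c v j + 1"
    using equitable_colouring[OF fin(1) q, of src dst] by (elim exE conjE)
  have c: "c e < q" if "e \<in> E" for e using c' that by simp
  have eq: "class_count E f c v i \<le> class_count E f c v j + 1" if "f = src \<or> f = dst" "i < q" "j < q" for f v i j
    using eq'[rule_format, OF that] .
  have one: "class_count E f c v i \<le> 1" if f: "f = src \<or> f = dst" and i: "i < q" for f v i
  proof (rule equitable_le[of q "class_count E f c v" 1 i, OF eq[OF f] _ i])
    show "(\<Sum>i<q. class_count E f c v i) \<le> q * 1" unfolding sum_class_count[OF fin(1) c'] using half f by auto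
  qed
  obtain g where g: "\<forall>j < q. g j \<in> I" "\<forall>i\<in>I. card {j. j < q \<and> g j = i} = a i"
    using block_map[OF fin(2), of a] unfolding q_def by blast
  have "vertex_degree {e \<in> E. g (c e) = i} tail head v \<le> 2 * a i" if i: "i \<in> I" for i v
  proof -
    have part: "card {e \<in> {e \<in> E. g (c e) = i}. f e = v} \<le> a i" if f: "f = src \<or> f = dst" for f
    proof -
      have "{e \<in> {e \<in> E. g (c e) = i}. f e = v} = (\<Union>j\<in>{j. j < q \<and> g j = i}. {e \<in> E. f e = v \<and> c e = j})"
        using c by auto
      then have "card {e \<in> {e \<in> E. g (c e) = i}. f e = v} \<le> (\<Sum>j\<in>{j. j < q \<and> g j = i}. class_count E f c v j)"
        unfolding class_count_def by (simp only:) (rule card_UN_le, simp)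
      also have "\<dots> \<le> (\<Sum>j\<in>{j. j < q \<and> g j = i}. 1)" by (rule sum_mono) (use one[OF f] in auto)
      finally show ?thesis using g(2) i by simp
    qed
    have "vertex_degree {e \<in> E. g (c e) = i} tail head v = vertex_degree {e \<in> E. g (c e) = i} src dst v"
      by (rule vertex_degree_orient[symmetric]) (use fin or in auto)
    then show ?thesis using part[of src] part[of dst] unfolding vertex_degree_def[of _ src dst] by simp
  qed
  then show ?thesis using c g(1) by (intro exI[of _ "\<lambda>e. g (c e)"]) auto
qed

section \<open>Splitting the edges into classes of bounded degree\<close>

lemma distribute_total:
  fixes s :: "'v \<Rightarrow> int"
  assumes "finite V" "\<And>v. v \<in> V \<Longrightarrow> 0 \<le> s v" "0 \<le> N" "N \<le> sum s V"
  shows "\<exists>j. (\<forall>v\<in>V. 0 \<le> j v \<and> j v \<le> s v) \<and> sum j V = N"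
  using assms
proof (induction V arbitrary: N)
  case empty
  then show ?case by simp
next
  case (insert x V)
  define m where "m = min N (s x)"
  have m: "0 \<le> m" "m \<le> s x" "0 \<le> N - m" "N - m \<le> sum s V"
    using insert.prems(1)[of x] insert.prems(2,3) insert.hyps sum_nonneg[of V s] insert.prems(1)
    unfolding m_def by auto
  then obtain j where j: "\<forall>v\<in>V. 0 \<le> j v \<and> j v \<le> s v" "sum j V = N - m"
    using insert.IH[of "N - m"] insert.prems(1) by auto
  have "sum (j(x := m)) V = sum j V" by (rule sum.cong) (use insert.hyps in auto)
  then have "sum (j(x := m)) (insert x V) = N" using insert.hyps j(2) by simp
  then show ?case using j(1) m by (intro exI[of _ "j(x := m)"]) auto
qed

text \<open>Here \<open>g\<close> and \<open>h\<close> count the out-ends and in-ends of each colour at a vertex whose deficiency is \<open>s\<close>. Adding \<open>j\<close> to the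
out-degree and \<open>s - j\<close> to the in-degree makes both divisible by \<open>k\<close>, with quotients \<open>\<alpha>\<close> and
\<open>p - \<alpha>\<close>, and equitable classes do not exceed these.\<close>
lemma class_degree_le:
  fixes g h :: "nat \<Rightarrow> nat" and j s :: int
  assumes k: "k \<ge> 1" and g: "\<And>i i'. i < k \<Longrightarrow> i' < k \<Longrightarrow> g i \<le> g i' + 1"
    and h: "\<And>i i'. i < k \<Longrightarrow> i' < k \<Longrightarrow> h i \<le> h i' + 1"
    and total: "int (sum g {..<k}) + int (sum h {..<k}) + s = int (k * p)"
    and j: "int k dvd int (sum g {..<k}) + j" "0 \<le> j" "j \<le> s" and i: "i < k"
  shows "g i + h i \<le> p"
proof -
  obtain \<alpha> where \<alpha>: "int (sum g {..<k}) + j = int k * \<alpha>" using j(1) by (rule dvdE)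
  have "int k * \<alpha> \<ge> 0" unfolding \<alpha>[symmetric] using j(2) by linarith
  then have \<alpha>0: "\<alpha> \<ge> 0" using k by (simp add: zero_le_mult_iff)
  have \<beta>: "int (sum h {..<k}) + (s - j) = int k * (int p - \<alpha>)"
    using total \<alpha> by (simp add: algebra_simps)
  have "int k * (int p - \<alpha>) \<ge> 0" unfolding \<beta>[symmetric] using j(3) by linarith
  then have \<beta>0: "int p - \<alpha> \<ge> 0" using k by (simp add: zero_le_mult_iff)
  have "int (sum g {..<k}) \<le> int k * \<alpha>" unfolding \<alpha>[symmetric] using j(2) by linarith
  then have "int (sum g {..<k}) \<le> int (k * nat \<alpha>)" using \<alpha>0 by simp
  then have "sum g {..<k} \<le> k * nat \<alpha>" by (simp only: of_nat_le_iff)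
  from equitable_le[OF g this i] have 1: "g i \<le> nat \<alpha>" .
  have "int (sum h {..<k}) \<le> int k * (int p - \<alpha>)" unfolding \<beta>[symmetric] using j(3) by linarith
  then have "int (sum h {..<k}) \<le> int (k * nat (int p - \<alpha>))" using \<beta>0 by simp
  then have "sum h {..<k} \<le> k * nat (int p - \<alpha>)" by (simp only: of_nat_le_iff)
  from equitable_le[OF h this i] have 2: "h i \<le> nat (int p - \<alpha>)" .
  show ?thesis using 1 2 \<alpha>0 \<beta>0 by linarith
qed

text \<open>The orientation and its equitable colouring enter the degree counts only through the numbers \<open>g v i\<close> and \<open>h v i\<close> of out-ends
and in-ends of colour \<open>i\<close> at \<open>v\<close>.\<close>
lemma oriented_colouring:
  fixes V :: "'v set" and E :: "'e set" and k :: nat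
  assumes k: "k \<ge> 1" and fin: "finite V" "finite E" and ends: "\<forall>e\<in>E. tail e \<in> V \<and> head e \<in> V"
    and conn: "\<forall>A. A \<noteq> {} \<and> A \<subset> V \<longrightarrow> 3 * int k - 3 \<le> cut_count E tail head A"
    and f: "int k dvd sum f V - int (card E)"
  shows "\<exists>c g h. (\<forall>e\<in>E. c e < k) \<and>
    (\<forall>v i. i < k \<longrightarrow> vertex_degree {e \<in> E. c e = i} tail head v = g v i + h v i) \<and>
    (\<forall>v i j. i < k \<longrightarrow> j < k \<longrightarrow> g v i \<le> g v j + 1 \<and> h v i \<le> h v j + 1) \<and>
    (\<forall>v. sum (g v) {..<k} + sum (h v) {..<k} = vertex_degree E tail head v) \<and>
    (\<forall>v\<in>V. int k dvd int (sum (g v) {..<k}) - f v)"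
proof -
  have "\<exists>src dst. (\<forall>e. src e = tail e \<and> dst e = head e \<or> src e = head e \<and> dst e = tail e) \<and>
    (\<forall>v\<in>V. int k dvd int (card {e \<in> E. src e = v}) - f v)"
    by (rule modular_orientation[OF k fin _ _ f]) (use ends conn in auto)
  then obtain src dst where or: "\<forall>e. src e = tail e \<and> dst e = head e \<or> src e = head e \<and> dst e = tail e"
    and out: "\<forall>v\<in>V. int k dvd int (card {e \<in> E. src e = v}) - f v"
    by (elim exE conjE)
  obtain c where c: "\<forall>e\<in>E. c e < k"
    and eq: "\<forall>f v i j. f = src \<or> f = dst \<longrightarrow> i < k \<longrightarrow> j < k \<longrightarrow> class_count E f c v i \<le> class_count E f c v j + 1"
    using equitable_colouring[OF fin(2) k, of src dst] by (elim exE conjE)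
  have s: "sum (class_count E f' c v) {..<k} = card {e \<in> E. f' e = v}" for f' :: "'e \<Rightarrow> 'v" and v
    by (rule sum_class_count[OF fin(2) c])
  have d: "vertex_degree E' src dst v = vertex_degree E' tail head v" if "E' \<subseteq> E" for E' v
    by (rule vertex_degree_orient) (use that fin finite_subset or in auto)
  show ?thesis
  proof (rule exI[of _ c], rule exI[of _ "class_count E src c"], rule exI[of _ "class_count E dst c"], intro conjI allI impI ballI)
    fix v i
    show "vertex_degree {e \<in> E. c e = i} tail head v = class_count E src c v i + class_count E dst c v i"
      using vertex_degree_colour[of E c i src dst v] d[of "{e \<in> E. c e = i}" v] by auto
  next
    fix v i j assume "i < k" "j < k"
    then show "class_count E src c v i \<le> class_count E src c v j + 1" "class_count E dst c v i \<le> class_count E dst c v j + 1"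
      using eq[rule_format, of src i j v] eq[rule_format, of dst i j v] by auto
  next
    fix v
    show "sum (class_count E src c v) {..<k} + sum (class_count E dst c v) {..<k} = vertex_degree E tail head v"
      using d[of E v] unfolding s vertex_degree_def by simp
  next
    fix v assume "v \<in> V"
    then show "int k dvd int (sum (class_count E src c v) {..<k}) - f v" unfolding s using out by blast
  next
    fix e assume "e \<in> E"
    then show "c e < k" using c by blast
  qed
qed

text \<open>At the exceptional vertex, \<open>D i\<close> is the degree of colour \<open>i\<close>, \<open>s\<close> its deficiency and \<open>S\<close> the total deficiency.
Colours of degree \<open>p + 1\<close> are not chosen, and they are few: since the degrees average \<open>p - s / k\<close>, there are
\<open>s\<close> more colours of degree \<open>p - 1\<close> than of degree \<open>p + 1\<close>, which leaves at least \<open>k - s - 2 * r = S - s\<close>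
colours of degree \<open>p\<close>. Choosing these first, at most \<open>s\<close> colours of degree \<open>p - 1\<close> are needed, so the colours that
are left over carry at most \<open>(k - t) * p\<close>.\<close>
lemma choose_classes:
  fixes D :: "nat \<Rightarrow> nat" and s S r :: int
  assumes near: "\<And>i. i < k \<Longrightarrow> D i + 1 = p \<or> D i = p \<or> D i = p + 1"
    and total: "int (sum D {..<k}) + s = int (k * p)" and s: "0 \<le> s"
    and over: "int (card {i. i < k \<and> D i = p + 1}) \<le> r" and r: "2 * r = int k - S" and t: "int t \<le> S"
  shows "\<exists>T \<subseteq> {..<k}. card T = t \<and> (\<forall>i\<in>T. D i \<le> p) \<and> sum D ({..<k} - T) \<le> (k - t) * p"
proof -
  define N where "N = {i. i < k \<and> D i = p + 1}"
  define Z where "Z = {i. i < k \<and> D i = p}"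
  define U where "U = {i. i < k \<and> D i + 1 = p}"
  have fin: "finite N" "finite Z" "finite U" unfolding N_def Z_def U_def by auto
  have part: "{..<k} = N \<union> Z \<union> U" unfolding N_def Z_def U_def using near by auto
  have disj: "N \<inter> Z = {}" "(N \<union> Z) \<inter> U = {}" unfolding N_def Z_def U_def by auto
  have cards: "card N + card Z + card U = k"
    using card_Un_disjoint[OF _ fin(3) disj(2)] card_Un_disjoint[OF fin(1,2) disj(1)] fin
    unfolding part[symmetric] by simp
  have sN: "(\<Sum>i\<in>N. int (D i)) = int (card N) * (int p + 1)" unfolding N_def by simp
  have sZ: "(\<Sum>i\<in>Z. int (D i)) = int (card Z) * int p" unfolding Z_def by simp
  have sO: "(\<Sum>i\<in>B. int (D i)) = int (card B) * (int p - 1)" if "B \<subseteq> U" for B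
  proof -
    have "(\<Sum>i\<in>B. int (D i)) = (\<Sum>i\<in>B. int p - 1)"
      by (rule sum.cong) (use that in \<open>auto simp: U_def\<close>)
    then show ?thesis by simp
  qed
  have "int (sum D {..<k}) = (\<Sum>i\<in>N. int (D i)) + (\<Sum>i\<in>Z. int (D i)) + (\<Sum>i\<in>U. int (D i))"
    unfolding part using fin disj by (simp add: sum.union_disjoint)
  also have "\<dots> = int (card N + card Z + card U) * int p + int (card N) - int (card U)"
    unfolding sN sZ sO[OF order.refl] by (simp add: algebra_simps)
  finally have sO': "int (card U) = s + int (card N)" using total unfolding cards by (simp add: algebra_simps)
  have "int (card N) \<le> r" using over unfolding N_def .
  then have Z: "int t \<le> int (card Z) + s" using sO' cards r t by linarith
  have "t \<le> card Z + card U" using sO' Z by linarith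
  then have tU: "t - card Z \<le> card U" by simp
  obtain B where B: "B \<subseteq> U" "card B = t - card Z"
    using obtain_subset_with_card_n[of "t - card Z" U] tU by auto
  obtain A where A: "A \<subseteq> Z" "card A = min t (card Z)"
    using obtain_subset_with_card_n[of "min t (card Z)" Z] by auto
  have finAB: "finite A" "finite B" using A B fin finite_subset by blast+
  have dAB: "A \<inter> B = {}" using A B disj by blast
  define T where "T = A \<union> B"
  have Tk: "T \<subseteq> {..<k}" unfolding T_def part using A B by blast
  have cT: "card T = t" unfolding T_def using card_Un_disjoint[OF finAB dAB] A B by simp
  have "int (card B) \<le> s" using B Z s by linarith
  moreover have "(\<Sum>i\<in>T. int (D i)) = int (card A) * int p + int (card B) * (int p - 1)"
  proof -
    have "(\<Sum>i\<in>A. int (D i)) = (\<Sum>i\<in>A. int p)" by (rule sum.cong) (use A in \<open>auto simp: Z_def\<close>)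
    then show ?thesis unfolding T_def sum.union_disjoint[OF finAB dAB] using sO[OF B(1)] by simp
  qed
  moreover have "int t * int p = int (card A) * int p + int (card B) * int p"
  proof -
    have "int t = int (card A) + int (card B)" using A B by simp
    then show ?thesis by (simp only: distrib_right)
  qed
  ultimately have "(\<Sum>i\<in>T. int (D i)) + s \<ge> int t * int p" by (simp add: algebra_simps)
  moreover have "int (sum D {..<k}) = (\<Sum>i\<in>T. int (D i)) + int (sum D ({..<k} - T))"
    using sum.subset_diff[OF Tk, of D] by simp
  moreover have "t \<le> k" using card_mono[OF _ Tk] cT by simp
  ultimately have "int (sum D ({..<k} - T)) \<le> int ((k - t) * p)"
    using total by (simp add: of_nat_diff algebra_simps)
  then have "sum D ({..<k} - T) \<le> (k - t) * p" by (simp only: of_nat_le_iff)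
  moreover have "\<forall>i\<in>T. D i \<le> p" unfolding T_def using A B unfolding Z_def U_def by auto
  ultimately show ?thesis using Tk cT by blast
qed

lemma quotient_remainder:
  fixes x k :: nat and r :: int
  assumes "int k dvd int x - r" "0 \<le> r" "r < int k"
  shows "x = k * (x div k) + nat r"
proof -
  have "int (x mod k) = int x mod int k" by (rule of_nat_mod)
  also have "\<dots> = r mod int k" using assms(1) by (simp only: mod_eq_dvd_iff)
  also have "\<dots> = r" using assms(2,3) by simp
  finally have "x mod k = nat r" by simp
  then show ?thesis using mult_div_mod_eq[of k x] by simp
qed

text \<open>The deficiencies \<open>s v\<close> sum to \<open>S\<close>, and twice the number of edges is \<open>k * p * card V - S\<close>. By
\<open>class_degree_le\<close>, numbers \<open>j v\<close> between \<open>0\<close> and \<open>s v\<close> whose sum is congruent to minus the number of edges make all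
colours have degree at most \<open>p\<close>. For even order the sum \<open>S / 2\<close> does, for odd order \<open>(S - k) / 2\<close>, provided that
this is not negative. If it is, one vertex \<open>z\<close> absorbs the difference: its out-degree has residue
\<open>(k - S) / 2\<close>.\<close>
theorem colour_split:
  fixes V :: "'v set" and E :: "'e set" and k p t :: nat
  assumes k: "k \<ge> 1" and p: "odd p" and fin: "finite V" "V \<noteq> {}" "finite E"
    and ends: "\<forall>e\<in>E. tail e \<in> V \<and> head e \<in> V"
    and conn: "\<forall>A. A \<noteq> {} \<and> A \<subset> V \<longrightarrow> 3 * int k - 3 \<le> cut_count E tail head A"
    and deg: "\<And>v. v \<in> V \<Longrightarrow> vertex_degree E tail head v \<le> k * p"
    and t: "t \<le> k"
    and room: "even (card V) \<or> int t \<le> (\<Sum>v\<in>V. int (k * p) - int (vertex_degree E tail head v))"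
  shows "\<exists>c T. (\<forall>e\<in>E. c e < k) \<and> T \<subseteq> {..<k} \<and> card T = t \<and>
    (\<forall>v\<in>V. (\<forall>i\<in>T. vertex_degree {e \<in> E. c e = i} tail head v \<le> p) \<and>
      (\<Sum>i\<in>{..<k} - T. vertex_degree {e \<in> E. c e = i} tail head v) \<le> (k - t) * p)"
proof -
  define s where "s v = int (k * p) - int (vertex_degree E tail head v)" for v
  define S where "S = sum s V"
  have s0: "0 \<le> s v" if "v \<in> V" for v
  proof -
    have "int (vertex_degree E tail head v) \<le> int (k * p)" using deg[OF that] by (simp only: of_nat_le_iff)
    then show ?thesis unfolding s_def by simp
  qed
  have S: "2 * int (card E) = int k * int p * int (card V) - S"
  proof -
    have "S = int (card V) * int (k * p) - int (\<Sum>v\<in>V. vertex_degree E tail head v)"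
      unfolding S_def s_def by (simp add: sum_subtractf)
    also have "(\<Sum>v\<in>V. vertex_degree E tail head v) = 2 * card E" by (rule handshake[OF fin(1,3)]) (use ends in blast)
    finally show ?thesis by simp
  qed
  have spread: ?thesis if j: "\<And>v. v \<in> V \<Longrightarrow> 0 \<le> j v \<and> j v \<le> s v" and dvd: "int k dvd - sum j V - int (card E)" for j
  proof -
    have dvd': "int k dvd (\<Sum>v\<in>V. - j v) - int (card E)" using dvd by (simp add: sum_negf)
    obtain c g h where c: "\<forall>e\<in>E. c e < k"
      and d: "\<forall>v i. i < k \<longrightarrow> vertex_degree {e \<in> E. c e = i} tail head v = g v i + h v i"
      and eq: "\<forall>v i j. i < k \<longrightarrow> j < k \<longrightarrow> g v i \<le> g v j + 1 \<and> h v i \<le> h v j + 1"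
      and tot: "\<forall>v. sum (g v) {..<k} + sum (h v) {..<k} = vertex_degree E tail head v"
      and res: "\<forall>v\<in>V. int k dvd int (sum (g v) {..<k}) - - j v"
      using oriented_colouring[OF k fin(1,3) ends conn dvd'] by (elim exE conjE)
    have le: "vertex_degree {e \<in> E. c e = i} tail head v \<le> p" if v: "v \<in> V" and i: "i < k" for v i
    proof -
      have "g v i + h v i \<le> p"
      proof (rule class_degree_le[OF k, where g = "g v" and h = "h v" and s = "s v" and j = "j v"])
        show "int (sum (g v) {..<k}) + int (sum (h v) {..<k}) + s v = int (k * p)"
          using tot[rule_format, of v] unfolding s_def by linarith
        show "int k dvd int (sum (g v) {..<k}) + j v" using res v by simp
      qed (use eq j v i in auto)
      then show ?thesis using d i by simp
    qed
    have "(\<Sum>i\<in>{..<k} - {..<t}. vertex_degree {e \<in> E. c e = i} tail head v) \<le> (k - t) * p" if v: "v \<in> V" for v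
    proof -
      have "(\<Sum>i\<in>{..<k} - {..<t}. vertex_degree {e \<in> E. c e = i} tail head v) \<le> (\<Sum>i\<in>{..<k} - {..<t}. p)"
        by (rule sum_mono) (use le[OF v] in auto)
      also have "\<dots> = (k - t) * p" using t by (simp add: card_Diff_subset)
      finally show ?thesis .
    qed
    then show ?thesis using c le t by (intro exI[of _ c] exI[of _ "{..<t}"]) auto
  qed
  have target: ?thesis if N: "0 \<le> N" "N \<le> S" and dvd: "int k dvd - N - int (card E)" for N
  proof -
    obtain j where "\<forall>v\<in>V. 0 \<le> j v \<and> j v \<le> s v" "sum j V = N"
      using distribute_total[OF fin(1) s0 N[unfolded S_def]] by blast
    then show ?thesis using spread[of j] dvd by blast
  qed
  show ?thesis
  proof (cases "even (card V)")
    case True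
    then obtain m where m: "card V = 2 * m" by (elim evenE)
    have E: "2 * int (card E) = 2 * (int k * int p * int m) - S" unfolding S m by simp
    then have "even S" by presburger
    then obtain N where N: "S = 2 * N" by (elim evenE)
    have "- N - int (card E) = int k * (- int p * int m)" using E N by simp
    moreover have "0 \<le> S" unfolding S_def by (rule sum_nonneg) (rule s0)
    ultimately show ?thesis using N by (intro target[of N]) simp_all
  next
    case False
    then have "odd (p * card V)" using p by simp
    then obtain m where m: "p * card V = 2 * m + 1" by (elim oddE)
    have E: "2 * int (card E) = 2 * (int k * int m) + int k - S"
    proof -
      have "int k * int p * int (card V) = int k * int (p * card V)" by simp
      then show ?thesis unfolding S m by (simp add: algebra_simps)
    qed
    then have par: "even (int k - S)" by presburger
    then obtain r where r: "int k - S = 2 * r" by (elim evenE)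
    have E': "int (card E) = int k * int m + r" using E r by simp
    have tS: "int t \<le> S" using room False unfolding S_def s_def by simp
    show ?thesis
    proof (cases "S \<ge> int k")
      case True
      then show ?thesis using E' r by (intro target[of "- r"]) auto
    next
      case small: False
      obtain z where z: "z \<in> V" using fin(2) by blast
      \<comment> \<open>only the residue at \<open>z\<close> is constrained, by the number of edges\<close>
      define f where "f v = int (card E) * of_bool (v = z)" for v
      have "sum f V = int (card E)"
        unfolding f_def sum_distrib_left[symmetric] using sum_of_bool_eq[OF fin(1), of z] z by simp
      then have dvd': "int k dvd sum f V - int (card E)" by simp
      obtain c g h where c: "\<forall>e\<in>E. c e < k"
        and d: "\<forall>v i. i < k \<longrightarrow> vertex_degree {e \<in> E. c e = i} tail head v = g v i + h v i"
        and eq: "\<forall>v i j. i < k \<longrightarrow> j < k \<longrightarrow> g v i \<le> g v j + 1 \<and> h v i \<le> h v j + 1"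
        and tot: "\<forall>v. sum (g v) {..<k} + sum (h v) {..<k} = vertex_degree E tail head v"
        and res: "\<forall>v\<in>V. int k dvd int (sum (g v) {..<k}) - f v"
        using oriented_colouring[OF k fin(1,3) ends conn dvd'] by (elim exE conjE)
      have tot': "int (sum (g v) {..<k}) + int (sum (h v) {..<k}) + s v = int (k * p)" for v
        using tot[rule_format, of v] unfolding s_def by linarith
      have le: "vertex_degree {e \<in> E. c e = i} tail head v \<le> p" if v: "v \<in> V" "v \<noteq> z" and i: "i < k" for v i
      proof -
        have "g v i + h v i \<le> p"
        proof (rule class_degree_le[OF k _ _ tot', where j = 0])
          show "int k dvd int (sum (g v) {..<k}) + 0" using res[rule_format, OF v(1)] v(2) by (simp add: f_def)
        qed (use eq s0 v i in auto)
        then show ?thesis using d i by simp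
      qed
      define D where "D i = vertex_degree {e \<in> E. c e = i} tail head z" for i
      have D: "D i = g z i + h z i" if "i < k" for i using d that unfolding D_def by simp
      have sumD: "int (sum D {..<k}) + s z = int (k * p)"
      proof -
        have "sum D {..<k} = sum (g z) {..<k} + sum (h z) {..<k}"
          unfolding sum.distrib[symmetric] by (rule sum.cong) (use D in auto)
        then show ?thesis using tot'[of z] by simp
      qed
      have sz: "s z \<le> S" unfolding S_def by (rule member_le_sum) (use z s0 fin in auto)
      have r0: "0 < r" "2 * r \<le> int k" using small r tS by auto
      define a where "a = sum (g z) {..<k} div k"
      define b where "b = sum (h z) {..<k} div k"
      have kr: "int k dvd int (sum (g z) {..<k}) - r"
      proof -
        have "int k dvd int (sum (g z) {..<k}) - (int k * int m + r)"
          using res[rule_format, OF z] E' by (simp add: f_def)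
        then have "int k dvd (int (sum (g z) {..<k}) - (int k * int m + r)) + int k * int m"
          by (intro dvd_add dvd_triv_left)
        then show ?thesis by simp
      qed
      have nat_out: "sum (g z) {..<k} = k * a + nat r"
        unfolding a_def by (rule quotient_remainder[OF kr]) (use r0 in auto)
      have out: "int (sum (g z) {..<k}) = int k * int a + r" unfolding nat_out using r0 by simp
      \<comment> \<open>\<open>r\<close> colours have one out-end more than the others at \<open>z\<close>, and \<open>q\<close> colours one in-end more; a colour of degree \<open>p + 1\<close> has both\<close>
      define q where "q = int k - s z - r"
      have q: "0 < q" "q < int k" using sz r r0 small s0[OF z] unfolding q_def by linarith+
      have "int (sum (h z) {..<k}) - q = int k * (int p - int a - 1)"
        using tot'[of z] unfolding q_def out by (simp add: algebra_simps)
      then have kq: "int k dvd int (sum (h z) {..<k}) - q" by (simp only: dvd_triv_left)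
      have nat_into: "sum (h z) {..<k} = k * b + nat q"
        unfolding b_def by (rule quotient_remainder[OF kq]) (use q in auto)
      have into: "int (sum (h z) {..<k}) = int k * int b + q" unfolding nat_into using q by simp
      have abp: "a + b + 1 = p"
      proof -
        have "int k * (int a + int b + 1) = int k * int p"
          using tot'[of z] unfolding out into q_def by (simp add: algebra_simps)
        then have "int a + int b + 1 = int p" using k by simp
        then show ?thesis by linarith
      qed
      have eqg: "g z i \<le> g z i' + 1" and eqh: "h z i \<le> h z i' + 1" if "i < k" "i' < k" for i i'
        using eq that by auto
      have rk: "nat r < k" "nat q < k" using r0 q by linarith+
      have gv: "g z i = a \<or> g z i = a + 1" if "i < k" for i
        by (rule equitable_values(1)[OF eqg nat_out rk(1) that])
      have hv: "h z i = b \<or> h z i = b + 1" if "i < k" for i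
        by (rule equitable_values(1)[OF eqh nat_into rk(2) that])
      have gr: "card {i. i < k \<and> g z i = a + 1} = nat r"
        by (rule equitable_values(2)[OF eqg nat_out rk(1)])
      have near: "D i + 1 = p \<or> D i = p \<or> D i = p + 1" if "i < k" for i
        using gv[OF that] hv[OF that] D[OF that] abp by auto
      have "{i. i < k \<and> D i = p + 1} \<subseteq> {i. i < k \<and> g z i = a + 1}"
      proof
        fix i assume "i \<in> {i. i < k \<and> D i = p + 1}"
        then have i: "i < k" "D i = p + 1" by auto
        then have "g z i = a + 1" using gv[OF i(1)] hv[OF i(1)] D[OF i(1)] abp by auto
        then show "i \<in> {i. i < k \<and> g z i = a + 1}" using i by simp
      qed
      then have "card {i. i < k \<and> D i = p + 1} \<le> nat r"
        unfolding gr[symmetric] by (intro card_mono) auto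
      then have over: "int (card {i. i < k \<and> D i = p + 1}) \<le> r" using r0 by linarith
      obtain T where T: "T \<subseteq> {..<k}" "card T = t" "\<forall>i\<in>T. D i \<le> p" "sum D ({..<k} - T) \<le> (k - t) * p"
        using choose_classes[OF near sumD s0[OF z] over r[symmetric] tS] by blast
      have rest: "(\<Sum>i\<in>{..<k} - T. vertex_degree {e \<in> E. c e = i} tail head v) \<le> (k - t) * p" if v: "v \<in> V" for v
      proof (cases "v = z")
        case True
        then show ?thesis using T(4) unfolding D_def by simp
      next
        case False
        have "(\<Sum>i\<in>{..<k} - T. vertex_degree {e \<in> E. c e = i} tail head v) \<le> (\<Sum>i\<in>{..<k} - T. p)"
          by (rule sum_mono) (use le[OF v False] in auto)
        also have "\<dots> = (k - t) * p"
          using T(1,2) finite_subset[OF T(1)] by (simp add: card_Diff_subset)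
        finally show ?thesis .
      qed
      have first: "vertex_degree {e \<in> E. c e = i} tail head v \<le> p" if "v \<in> V" "i \<in> T" for v i
        using le[of v i] T that unfolding D_def by (cases "v = z") auto
      show ?thesis
        using c T(1,2) first rest by (intro exI[of _ c] exI[of _ T]) blast
    qed
  qed
qed

section \<open>Multigraphs and their factors\<close>

lemma degree_eq_vertex_degree:
  assumes "finite (edges G)" "\<And>e. e \<in> edges G \<Longrightarrow> ends G e = Upair (tail e) (head e)"
  shows "degree G v = vertex_degree (edges G) tail head v"
proof -
  have 1: "{e \<in> edges G. v \<in> set_uprod (ends G e)} = {e \<in> edges G. tail e = v} \<union> {e \<in> edges G. head e = v}"
    using assms(2) by auto
  have 2: "{e \<in> edges G. ends G e = Upair v v} = {e \<in> edges G. tail e = v} \<inter> {e \<in> edges G. head e = v}"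
    using assms(2) by auto
  show ?thesis unfolding degree_def vertex_degree_def 1 2
    by (rule card_Un_Int[symmetric]) (use assms(1) in auto)
qed

lemma cut_size_eq_cut_count:
  assumes "finite (edges G)" "\<And>e. e \<in> edges G \<Longrightarrow> ends G e = Upair (tail e) (head e)"
  shows "int (cut_size G A) = cut_count (edges G) tail head A"
proof -
  have "{e \<in> edges G. \<exists>u v. ends G e = Upair u v \<and> u \<in> A \<and> v \<notin> A}
      = {e \<in> edges G. (tail e \<in> A) \<noteq> (head e \<in> A)}"
  proof (rule Collect_cong, rule conj_cong[OF refl])
    fix e assume "e \<in> edges G"
    then have "ends G e = Upair (tail e) (head e)" by (rule assms(2))
    then show "(\<exists>u v. ends G e = Upair u v \<and> u \<in> A \<and> v \<notin> A) \<longleftrightarrow> (tail e \<in> A) \<noteq> (head e \<in> A)"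
      by (cases "tail e \<in> A"; cases "head e \<in> A") (simp; blast)+
  qed
  then show ?thesis unfolding cut_size_def cut_count_def card_eq_sum[OF assms(1), symmetric] by simp
qed

lemma max_degree_le_iff:
  assumes "multigraph G"
  shows "max_degree G \<le> d \<longleftrightarrow> (\<forall>v\<in>verts G. degree G v \<le> d)"
  using assms unfolding max_degree_def multigraph_def by (subst Max_le_iff) auto

lemma choose_ends:
  obtains tail head where "\<And>e. ends G e = Upair (tail e) (head e)"
proof -
  have "\<exists>x. ends G e = Upair (fst x) (snd x)" for e
    by (cases "ends G e") auto
  then obtain f where "\<And>e. ends G e = Upair (fst (f e)) (snd (f e))" by metis
  then show thesis by (rule that)
qed

lemma vertex_degree_Un_le: "vertex_degree (A \<union> B) tail head v \<le> vertex_degree A tail head v + vertex_degree B tail head v"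
proof -
  have "{e \<in> A \<union> B. f e = v} = {e \<in> A. f e = v} \<union> {e \<in> B. f e = v}" for f :: "'a \<Rightarrow> 'b" by auto
  then show ?thesis unfolding vertex_degree_def
    using card_Un_le[of "{e \<in> A. tail e = v}" "{e \<in> B. tail e = v}"]
      card_Un_le[of "{e \<in> A. head e = v}" "{e \<in> B. head e = v}"] by simp
qed

lemma vertex_degree_UN:
  assumes "finite I" "\<And>i. i \<in> I \<Longrightarrow> finite (X i)" "disjoint_family_on X I"
  shows "vertex_degree (\<Union>i\<in>I. X i) tail head v = (\<Sum>i\<in>I. vertex_degree (X i) tail head v)"
proof -
  have "card {e \<in> (\<Union>i\<in>I. X i). f e = v} = (\<Sum>i\<in>I. card {e \<in> X i. f e = v})" for f :: "'b \<Rightarrow> 'c"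
  proof -
    have "{e \<in> (\<Union>i\<in>I. X i). f e = v} = (\<Union>i\<in>I. {e \<in> X i. f e = v})" by auto
    moreover have "card (\<Union>i\<in>I. {e \<in> X i. f e = v}) = (\<Sum>i\<in>I. card {e \<in> X i. f e = v})"
      by (rule card_UN_disjoint) (use assms in \<open>auto simp: disjoint_family_on_def\<close>)
    ultimately show ?thesis by simp
  qed
  then show ?thesis unfolding vertex_degree_def by (simp only: sum.distrib)
qed

text \<open>Each factor with an odd bound has a positive deficiency, since on an odd number of vertices its degrees cannot all
equal the bound.\<close>
lemma decomposition_room:
  assumes G: "multigraph G" and odd: "odd (card (verts G))"
    and F: "edge_decomposition G m F" and \<Delta>: "\<And>i. i \<in> {1..m} \<Longrightarrow> max_degree (F i) \<le> \<Delta> i"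
  shows "int (card {i \<in> {1..m}. odd (\<Delta> i)}) \<le> (\<Sum>v\<in>verts G. int (\<Sum>i=1..m. \<Delta> i) - int (degree G v))"
proof -
  obtain tail head where e: "\<And>e. ends G e = Upair (tail e) (head e)" using choose_ends[of G] by metis
  have V: "finite (verts G)" "finite (edges G)" using G unfolding multigraph_def by auto
  have ends: "\<And>e'. e' \<in> edges G \<Longrightarrow> tail e' \<in> verts G \<and> head e' \<in> verts G"
    using G e unfolding multigraph_def by auto
  have fac: "multigraph (F i)" "verts (F i) = verts G" "edges (F i) \<subseteq> edges G" "finite (edges (F i))"
    "\<And>e. e \<in> edges (F i) \<Longrightarrow> ends (F i) e = Upair (tail e) (head e)" if "i \<in> {1..m}" for i
  proof -
    have f: "is_factor (F i) G" using F that unfolding edge_decomposition_def by blast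
    then show "multigraph (F i)" "verts (F i) = verts G" "edges (F i) \<subseteq> edges G"
      unfolding is_factor_def by auto
    then show "finite (edges (F i))" unfolding multigraph_def by simp
    show "ends (F i) e = Upair (tail e) (head e)" if "e \<in> edges (F i)" for e
      using f that e[of e] unfolding is_factor_def by simp
  qed
  have di: "degree (F i) v = vertex_degree (edges (F i)) tail head v" if "i \<in> {1..m}" for i v
    using degree_eq_vertex_degree fac(4,5)[OF that] by metis
  have dG: "degree G v = (\<Sum>i=1..m. vertex_degree (edges (F i)) tail head v)" for v
  proof -
    have "degree G v = vertex_degree (edges G) tail head v" by (rule degree_eq_vertex_degree) (use V e in auto)
    also have "edges G = (\<Union>i\<in>{1..m}. edges (F i))" using F unfolding edge_decomposition_def by auto
    also have "vertex_degree (\<Union>i\<in>{1..m}. edges (F i)) tail head v = (\<Sum>i=1..m. vertex_degree (edges (F i)) tail head v)"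
      by (rule vertex_degree_UN) (use fac F in \<open>auto simp: edge_decomposition_def\<close>)
    finally show ?thesis .
  qed
  have gap: "of_bool (odd (\<Delta> i)) \<le> (\<Sum>v\<in>verts G. int (\<Delta> i) - int (vertex_degree (edges (F i)) tail head v))"
    if i: "i \<in> {1..m}" for i
  proof -
    let ?g = "\<Sum>v\<in>verts G. int (\<Delta> i) - int (vertex_degree (edges (F i)) tail head v)"
    have "vertex_degree (edges (F i)) tail head v \<le> \<Delta> i" if "v \<in> verts G" for v
      using \<Delta>[OF i] max_degree_le_iff[OF fac(1)[OF i]] fac(2)[OF i] di[OF i] that by auto
    then have "0 \<le> ?g" by (intro sum_nonneg) simp
    moreover have "?g = int (card (verts G)) * int (\<Delta> i) - 2 * int (card (edges (F i)))"
    proof -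
      have "(\<Sum>v\<in>verts G. vertex_degree (edges (F i)) tail head v) = 2 * card (edges (F i))"
        by (rule handshake[OF V(1) fac(4)[OF i]]) (use ends fac(3)[OF i] in blast)
      then have "int (\<Sum>v\<in>verts G. vertex_degree (edges (F i)) tail head v) = int (2 * card (edges (F i)))" by (simp only:)
      then show ?thesis by (simp add: sum_subtractf)
    qed
    moreover have "odd (int (card (verts G)) * int (\<Delta> i) - 2 * int (card (edges (F i))))" if "odd (\<Delta> i)"
      using that odd by simp
    ultimately have "?g \<noteq> 0" if "odd (\<Delta> i)" using that by (metis even_zero)
    then show ?thesis using \<open>0 \<le> ?g\<close> by (cases "odd (\<Delta> i)") auto
  qed
  have "int (card {i \<in> {1..m}. odd (\<Delta> i)}) = (\<Sum>i=1..m. of_bool (odd (\<Delta> i)))"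
    by (rule card_eq_sum) simp
  also have "\<dots> \<le> (\<Sum>i=1..m. \<Sum>v\<in>verts G. int (\<Delta> i) - int (vertex_degree (edges (F i)) tail head v))"
    by (rule sum_mono) (rule gap)
  also have "\<dots> = (\<Sum>v\<in>verts G. \<Sum>i=1..m. int (\<Delta> i) - int (vertex_degree (edges (F i)) tail head v))"
    by (rule sum.swap)
  also have "\<dots> = (\<Sum>v\<in>verts G. int (\<Sum>i=1..m. \<Delta> i) - int (degree G v))"
    unfolding dG by (simp add: sum_subtractf)
  finally show ?thesis .
qed

theorem theorem1p7:
  fixes G :: "('v, 'e) mgraph" and k m :: nat and p :: int and \<Delta> :: "nat \<Rightarrow> nat"
  assumes "k > 0"
    and "\<And>i. i \<in> {1..m} \<Longrightarrow> \<Delta> i > 0"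
    and "\<And>i. i \<in> {1..m} \<Longrightarrow> int (\<Delta> i) \<ge> p - 1"
    and "p - 1 \<ge> 2"
    and "odd p"
    and "int k * p = int (\<Sum>i=1..m. \<Delta> i)"
    and "multigraph G"
    and "edge_connected (3 * k - 3) G"
    and "max_degree G \<le> (\<Sum>i=1..m. \<Delta> i)"
  shows "(\<exists>F. edge_decomposition G m F \<and> (\<forall>i\<in>{1..m}. max_degree (F i) \<le> \<Delta> i)) \<longleftrightarrow>
    even (card (verts G)) \<or>
    (\<Sum>v\<in>verts G. int (\<Sum>i=1..m. \<Delta> i) - int (degree G v)) \<ge> int (card {i \<in> {1..m}. odd (\<Delta> i)}) - 1"
    (is "?decomposable \<longleftrightarrow> ?room")
proof
  assume ?decomposable
  then obtain F where F: "edge_decomposition G m F" "\<And>i. i \<in> {1..m} \<Longrightarrow> max_degree (F i) \<le> \<Delta> i" by blast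
  show ?room
  proof (cases "even (card (verts G))")
    case False
    from decomposition_room[where \<Delta> = \<Delta>, OF assms(7) False F(1)] F(2) show ?thesis by simp
  qed simp
next
  assume room: ?room
  obtain tail head where e: "\<And>e. ends G e = Upair (tail e) (head e)" using choose_ends[of G] by metis
  define V where "V = verts G"
  define E where "E = edges G"
  define Odd where "Odd = {i \<in> {1..m}. odd (\<Delta> i)}"
  define t where "t = card Odd"
  define q where "q = nat p"
  have pq: "p = int q" "odd q" "q \<ge> 3" using assms(4,5) unfolding q_def by (auto simp: even_nat_iff)
  have total: "(\<Sum>i=1..m. \<Delta> i) = k * q"
  proof -
    have "int (\<Sum>i=1..m. \<Delta> i) = int (k * q)" using assms(6) pq(1) by simp
    then show ?thesis by (simp only: of_nat_eq_iff)
  qed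
  have V: "finite V" "V \<noteq> {}" "finite E" using assms(7) unfolding multigraph_def V_def E_def by auto
  have inV: "\<forall>e\<in>E. tail e \<in> V \<and> head e \<in> V"
    using assms(7) e unfolding multigraph_def V_def E_def by auto
  have dG: "degree G v = vertex_degree E tail head v" for v
    unfolding E_def by (rule degree_eq_vertex_degree) (use V e E_def in auto)
  have conn: "\<forall>A. A \<noteq> {} \<and> A \<subset> V \<longrightarrow> 3 * int k - 3 \<le> cut_count E tail head A"
  proof (intro allI impI)
    fix A assume "A \<noteq> {} \<and> A \<subset> V"
    then have "int (3 * k - 3) \<le> int (cut_size G A)"
      using assms(8) unfolding edge_connected_def V_def by simp
    then show "3 * int k - 3 \<le> cut_count E tail head A"
      using cut_size_eq_cut_count[of G tail head A] V e assms(1) unfolding E_def by auto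
  qed
  have deg: "vertex_degree E tail head v \<le> k * q" if "v \<in> V" for v
    using assms(9) that unfolding max_degree_le_iff[OF assms(7)] dG total V_def by simp
  have finOdd: "finite Odd" unfolding Odd_def by simp
  have big: "q \<le> \<Delta> i" if "i \<in> Odd" for i
  proof -
    have "int (\<Delta> i) \<ge> int q - 1" "odd (\<Delta> i)" using assms(3)[of i] that pq(1) unfolding Odd_def by auto
    then show ?thesis using pq(2) by presburger
  qed
  have tk: "t \<le> k"
  proof -
    have "t * q = (\<Sum>i\<in>Odd. q)" unfolding t_def by simp
    also have "\<dots> \<le> (\<Sum>i\<in>Odd. \<Delta> i)" by (rule sum_mono) (rule big)
    also have "\<dots> \<le> (\<Sum>i=1..m. \<Delta> i)" by (rule sum_mono2) (auto simp: Odd_def)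
    finally show ?thesis using pq(3) unfolding total by simp
  qed
  have par: "even (k * q) \<longleftrightarrow> even t"
    unfolding total[symmetric] t_def Odd_def by (rule even_sum_iff) simp
  have room': "even (card V) \<or> int t \<le> (\<Sum>v\<in>V. int (k * q) - int (vertex_degree E tail head v))"
  proof (cases "even (card V)")
    case False
    have "(\<Sum>v\<in>V. int (k * q) - int (vertex_degree E tail head v)) = int (card V) * int (k * q) - 2 * int (card E)"
    proof -
      have "(\<Sum>v\<in>V. vertex_degree E tail head v) = 2 * card E" by (rule handshake[OF V(1,3)]) (use inV in blast)
      then have "int (\<Sum>v\<in>V. vertex_degree E tail head v) = int (2 * card E)" by (simp only:)
      then show ?thesis by (simp add: sum_subtractf)
    qed
    moreover have "even (int (card V) * int (k * q) - 2 * int (card E) - int t)" using False par by simp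
    moreover have "int t - 1 \<le> (\<Sum>v\<in>V. int (k * q) - int (vertex_degree E tail head v))"
      using room False unfolding total dG V_def t_def Odd_def by blast
    ultimately show ?thesis by presburger
  qed simp
  obtain c T where c: "\<forall>e\<in>E. c e < k" and T: "T \<subseteq> {..<k}" "card T = t"
    and cT: "\<forall>v\<in>V. (\<forall>i\<in>T. vertex_degree {e \<in> E. c e = i} tail head v \<le> q) \<and>
      (\<Sum>i\<in>{..<k} - T. vertex_degree {e \<in> E. c e = i} tail head v) \<le> (k - t) * q"
    using colour_split[OF _ pq(2) V inV conn deg tk room'] assms(1) by auto
  have finT: "finite T" using T(1) finite_subset by blast
  obtain h where h: "bij_betw h T Odd"
    using finite_same_card_bij[OF finT finOdd] T(2) unfolding t_def by blast
  \<comment> \<open>half of what factor \<open>i\<close> may still receive after an odd \<open>\<Delta> i\<close> has been given its own colour\<close>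
  define a where "a i = (\<Delta> i - (if i \<in> Odd then q else 0)) div 2" for i
  have a: "2 * a i + (if i \<in> Odd then q else 0) = \<Delta> i" if "i \<in> {1..m}" for i
    using that big[of i] pq(2) unfolding a_def by (auto simp: Odd_def)
  have suma: "2 * sum a {1..m} = (k - t) * q"
  proof -
    have "(\<Sum>i=1..m. 2 * a i + (if i \<in> Odd then q else 0)) = k * q"
      unfolding total[symmetric] by (rule sum.cong) (use a in auto)
    moreover have "(\<Sum>i=1..m. if i \<in> Odd then q else 0) = t * q"
    proof -
      have "{1..m} \<inter> Odd = Odd" unfolding Odd_def by auto
      then show ?thesis unfolding t_def by (simp add: sum.If_cases Int_def[symmetric])
    qed
    ultimately show ?thesis by (simp add: sum.distrib sum_distrib_left diff_mult_distrib)
  qed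
  define R where "R = {e \<in> E. c e \<notin> T}"
  have finR: "finite R" using V unfolding R_def by simp
  have dR: "vertex_degree R tail head v \<le> 2 * sum a {1..m}" for v
  proof (cases "v \<in> V")
    case True
    have "R = (\<Union>i\<in>{..<k} - T. {e \<in> E. c e = i})" unfolding R_def using c by auto
    then have "vertex_degree R tail head v = (\<Sum>i\<in>{..<k} - T. vertex_degree {e \<in> E. c e = i} tail head v)"
      by (simp only:) (rule vertex_degree_UN, use V in \<open>auto simp: disjoint_family_on_def\<close>)
    then show ?thesis using cT True suma by simp
  next
    case False
    then have "{e \<in> R. tail e = v} = {}" "{e \<in> R. head e = v} = {}" unfolding R_def using inV by auto
    then have "vertex_degree R tail head v = 0" unfolding vertex_degree_def by (simp only: card.empty)
    then show ?thesis by simp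
  qed
  obtain c' where c': "\<forall>e\<in>R. c' e \<in> {1..m}"
    and d': "\<forall>i\<in>{1..m}. \<forall>v. vertex_degree {e \<in> R. c' e = i} tail head v \<le> 2 * a i"
    using even_factors[OF finR finite_atLeastAtMost dR] by blast
  define col where "col e = (if c e \<in> T then h (c e) else c' e)" for e
  have col: "col e \<in> {1..m}" if "e \<in> E" for e
    using that c' h unfolding col_def R_def Odd_def bij_betw_def by auto
  define F where "F i = G\<lparr>edges := {e \<in> E. col e = i}\<rparr>" for i
  have mF: "multigraph (F i)" for i
    using assms(7) unfolding multigraph_def F_def E_def by auto
  have "edge_decomposition G m F"
    unfolding edge_decomposition_def is_factor_def
    using mF col by (auto simp: F_def E_def disjoint_family_on_def)
  moreover have "max_degree (F i) \<le> \<Delta> i" if i: "i \<in> {1..m}" for i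
    unfolding max_degree_le_iff[OF mF]
  proof
    fix v assume "v \<in> verts (F i)"
    then have v: "v \<in> V" unfolding F_def V_def by simp
    have "degree (F i) v = vertex_degree {e \<in> E. col e = i} tail head v"
      using degree_eq_vertex_degree[of "F i" tail head v] V e unfolding F_def by simp
    also have "{e \<in> E. col e = i} = {e \<in> E. c e \<in> T \<and> h (c e) = i} \<union> {e \<in> R. c' e = i}"
      unfolding col_def R_def by auto
    also have "vertex_degree \<dots> tail head v \<le> vertex_degree {e \<in> E. c e \<in> T \<and> h (c e) = i} tail head v + vertex_degree {e \<in> R. c' e = i} tail head v"
      by (rule vertex_degree_Un_le)
    also have "vertex_degree {e \<in> R. c' e = i} tail head v \<le> 2 * a i" using d' i by blast
    also have "vertex_degree {e \<in> E. c e \<in> T \<and> h (c e) = i} tail head v \<le> (if i \<in> Odd then q else 0)"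
    proof (cases "i \<in> Odd")
      case True
      then obtain j where j: "j \<in> T" "h j = i" using h unfolding bij_betw_def by auto
      then have "{e \<in> E. c e \<in> T \<and> h (c e) = i} = {e \<in> E. c e = j}"
        using h unfolding bij_betw_def inj_on_def by auto
      then show ?thesis using cT v j True by simp
    next
      case False
      then have none: "{e \<in> E. c e \<in> T \<and> h (c e) = i} = {}" using h unfolding bij_betw_def by auto
      show ?thesis unfolding none by (simp add: vertex_degree_def)
    qed
    finally show "degree (F i) v \<le> \<Delta> i" using a[OF i] by simp
  qed
  ultimately show ?decomposable by blast
qed

end
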